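(* Let $m,d$ be positive integers, let $U_{m,d}$ be the uniform matroid of rank $d$ on $m+d$ elements, and let $z_{m,d}^i$ be the coefficient of $t^i$ in its $Z$-polynomial $Z_{U_{m,d}}(t)$. Then $z_{m,d}^d=1$, and for every $0\le i\le d-1$, \[ z_{m,d}^i=\frac{\binom{d+2m}{i+m}\binom{d}{i}}{\binom{d+2m}{m}}\sum_{h=1}^{m}\frac{(-1)^{h+1}h}{m}\binom{i+m}{m-h}\binom{d-i-h+m-1}{m-1}. \]
   Context: Binomial coefficients are $\binom{x}{h}=x(x-1)\cdots(x-h+1)/h!$ for integers $h\ge0$. For a loopless matroid $M$ with lattice of flats $L(M)$, characteristic polynomial $\chi_M(t)$ and rank $\operatorname{rk}M$, the Kazhdan–Lusztig polynomial $P_M(t)$ is the unique assignment with $P_M=1$ if $\operatorname{rk}M=0$, $\deg P_M<\frac12\operatorname{rk}M$ if $\operatorname{rk}M>0$, and $t^{\operatorname{rk}M}P_M(t^{-1})=\sum_{F\in L(M)}\chi_{M_F}(t)P_{M^F}(t)$, where $M_F$ is the restriction of $M$ to the flat $F$ and $M^F$ is the contraction of $M$ by $F$. The $Z$-polynomial is $Z_M(t)=\sum_{F\in L(M)}t^{\operatorname{rk}M_F}P_{M^F}(t)$. *)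

theory Defs
  imports "HOL-Computational_Algebra.Polynomial" Complex_Main
begin

section \<open>Finite matroids\<close>

datatype 'a matroid = Matroid (ground: "'a set") (indep: "'a set set")

definition is_matroid :: "'a matroid \<Rightarrow> bool" where
  "is_matroid M \<longleftrightarrow>
     finite (ground M) \<and> indep M \<subseteq> Pow (ground M) \<and> {} \<in> indep M \<and>
     (\<forall>I\<in>indep M. \<forall>J. J \<subseteq> I \<longrightarrow> J \<in> indep M) \<and>
     (\<forall>I\<in>indep M. \<forall>J\<in>indep M. card I < card J \<longrightarrow> (\<exists>x\<in>J - I. insert x I \<in> indep M))"

definition loopless :: "'a matroid \<Rightarrow> bool" where
  "loopless M \<longleftrightarrow> (\<forall>x\<in>ground M. {x} \<in> indep M)"

definition rank_of :: "'a matroid \<Rightarrow> 'a set \<Rightarrow> nat" where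
  "rank_of M A = Max (card ` {I \<in> indep M. I \<subseteq> A})"

definition rk :: "'a matroid \<Rightarrow> nat" where
  "rk M = rank_of M (ground M)"

definition flats :: "'a matroid \<Rightarrow> 'a set set" where
  "flats M = {F. F \<subseteq> ground M \<and> (\<forall>x\<in>ground M - F. rank_of M F < rank_of M (insert x F))}"

definition restriction :: "'a matroid \<Rightarrow> 'a set \<Rightarrow> 'a matroid" where
  "restriction M F = Matroid F {I \<in> indep M. I \<subseteq> F}"

definition contraction :: "'a matroid \<Rightarrow> 'a set \<Rightarrow> 'a matroid" where
  "contraction M F = Matroid (ground M - F)
     {I. I \<subseteq> ground M - F \<and>
         (\<exists>B\<in>indep M. B \<subseteq> F \<and> card B = rank_of M F \<and> I \<union> B \<in> indep M)}"

definition uniform_matroid :: "'a set \<Rightarrow> nat \<Rightarrow> 'a matroid" where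
  "uniform_matroid E d = Matroid E {I. I \<subseteq> E \<and> card I \<le> d}"

section \<open>The characteristic polynomial\<close>

text \<open>The Moebius function of a finite family \<open>L\<close> of sets, ordered by inclusion.\<close>

function moebius :: "'a set set \<Rightarrow> 'a set \<Rightarrow> 'a set \<Rightarrow> int" where
  "moebius L X Y =
     (if X = Y then 1
      else if finite L \<and> X \<subset> Y then - (\<Sum>Z\<in>{Z \<in> L. X \<subseteq> Z \<and> Z \<subset> Y}. moebius L X Z)
      else 0)"
  by pat_completeness auto
termination
proof (relation "measure (\<lambda>(L, X, Y). card {W \<in> L. W \<subset> Y})", goal_cases)
  case 1
  show ?case by simp
next
  case (2 L X Y Z)
  then have "{W \<in> L. W \<subset> Z} \<subset> {W \<in> L. W \<subset> Y}" "finite {W \<in> L. W \<subset> Y}"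
    by auto
  then show ?case by (simp add: psubset_card_mono)
qed

declare moebius.simps [simp del]

text \<open>\<open>\<Inter>(flats M)\<close> is the bottom element of the lattice of flats; it is empty if \<open>M\<close> is loopless.\<close>

definition char_poly :: "'a matroid \<Rightarrow> int poly" where
  "char_poly M =
     (\<Sum>F\<in>flats M. monom (moebius (flats M) (\<Inter>(flats M)) F) (rk M - rank_of M F))"

section \<open>Kazhdan--Lusztig polynomials and Z-polynomials\<close>

text \<open>\<open>rev_poly n p\<close> is \<open>t ^ n * p (1 / t)\<close>, meaningful for \<open>degree p \<le> n\<close>; recall
  that \<open>reflect_poly p\<close> is \<open>t ^ degree p * p (1 / t)\<close>.\<close>

definition rev_poly :: "nat \<Rightarrow> int poly \<Rightarrow> int poly" where
  "rev_poly n p = monom 1 (n - degree p) * reflect_poly p"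

definition KL_assignment :: "('a matroid \<Rightarrow> int poly) \<Rightarrow> bool" where
  "KL_assignment P \<longleftrightarrow>
     (\<forall>M. is_matroid M \<and> loopless M \<longrightarrow>
        (rk M = 0 \<longrightarrow> P M = 1) \<and>
        (rk M > 0 \<longrightarrow> 2 * degree (P M) < rk M) \<and>
        rev_poly (rk M) (P M) =
          (\<Sum>F\<in>flats M. char_poly (restriction M F) * P (contraction M F)))"

text \<open>An assignment is determined by the conditions above only on loopless matroids, so the
  description is applied to its value at \<open>M\<close> rather than to the whole function.\<close>

definition KL_poly :: "'a matroid \<Rightarrow> int poly" where
  "KL_poly M = (THE p. \<exists>P. KL_assignment P \<and> P M = p)"

definition Z_poly :: "'a matroid \<Rightarrow> int poly" where
  "Z_poly M = (\<Sum>F\<in>flats M. monom 1 (rk (restriction M F)) * KL_poly (contraction M F))"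

end

theory Submission imports Defs begin

text \<open>Moebius inversion shows that the defining equation of the Kazhdan--Lusztig polynomials holds for all
  loopless matroids if and only if all \<open>Z\<close>-polynomials are palindromic. So \<open>P_M\<close> is the unique polynomial of
  degree less than \<open>rk M / 2\<close> that completes the contributions of the nonempty flats to a palindromic
  polynomial, which gives existence and uniqueness.

  For \<open>U_{m,d}\<close> this says that the numbers \<open>z\<^sup>i\<close> are determined by \<open>z\<^sup>d = 1\<close>, the symmetry
  \<open>z\<^sup>i = z\<^sup>d\<^sup>-\<^sup>i\<close>, and the vanishing for \<open>d \<le> 2i < 2d\<close> of the binomial inverse
  \<open>\<Sum>k\<le>i. (-1)\<^sup>k (m+d choose k) z_{m,d-k}\<^sup>i\<^sup>-\<^sup>k\<close>. For the claimed closed form the symmetry follows from a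
  recurrence of Pascal type, and the vanishing holds because, up to a constant factor, the inverse is an
  \<open>i\<close>-th difference of a polynomial of degree less than \<open>i\<close>.\<close>

section \<open>Rank, contraction and restriction\<close>

lemma is_matroidD:
  assumes "is_matroid M"
  shows "finite (ground M)" "{} \<in> indep M"
    and "I \<in> indep M \<Longrightarrow> I \<subseteq> ground M" "I \<in> indep M \<Longrightarrow> finite I"
    and "I \<in> indep M \<Longrightarrow> J \<subseteq> I \<Longrightarrow> J \<in> indep M"
    and "I \<in> indep M \<Longrightarrow> J \<in> indep M \<Longrightarrow> card I < card J \<Longrightarrow> \<exists>x\<in>J - I. insert x I \<in> indep M"
  using assms unfolding is_matroid_def by (auto intro: finite_subset)

lemma finite_indep_subsets: "is_matroid M \<Longrightarrow> finite {I \<in> indep M. I \<subseteq> A}"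
  by (rule finite_subset[of _ "Pow (ground M)"]) (auto dest: is_matroidD)

lemma card_le_rank_of:
  assumes "is_matroid M" "I \<in> indep M" "I \<subseteq> A"
  shows "card I \<le> rank_of M A"
  unfolding rank_of_def using assms finite_indep_subsets[OF assms(1)] by (intro Max_ge) auto

lemma rank_of_basis:
  assumes "is_matroid M"
  obtains B where "B \<in> indep M" "B \<subseteq> A" "card B = rank_of M A"
proof -
  have "rank_of M A \<in> card ` {I \<in> indep M. I \<subseteq> A}"
    unfolding rank_of_def using finite_indep_subsets[OF assms] is_matroidD(2)[OF assms]
    by (intro Max_in) auto
  then show thesis using that by auto
qed

text \<open>The augmentation axiom, applied with a largest independent subset of \<open>A\<close>,
  adds one element of \<open>A\<close> at a time. The induction is on the number of elements still
  missing.\<close>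

lemma indep_extends_to_basis:
  assumes "is_matroid M" "I \<in> indep M" "I \<subseteq> A"
  obtains B where "B \<in> indep M" "I \<subseteq> B" "B \<subseteq> A" "card B = rank_of M A"
proof -
  have "\<exists>B\<in>indep M. I \<subseteq> B \<and> B \<subseteq> A \<and> card B = rank_of M A"
    using assms(2,3)
  proof (induction "rank_of M A - card I" arbitrary: I rule: less_induct)
    case less
    show ?case
    proof (cases "card I < rank_of M A")
      case True
      obtain B where B: "B \<in> indep M" "B \<subseteq> A" "card B = rank_of M A"
        using rank_of_basis[OF assms(1)] .
      then obtain x where x: "x \<in> B - I" "insert x I \<in> indep M"
        using is_matroidD(6)[OF assms(1) less.prems(1) B(1)] True by auto
      have "card (insert x I) = Suc (card I)"
        using x is_matroidD(4)[OF assms(1) less.prems(1)] by auto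
      then have "\<exists>B\<in>indep M. insert x I \<subseteq> B \<and> B \<subseteq> A \<and> card B = rank_of M A"
        using True x B less.prems by (intro less.hyps) auto
      then show ?thesis by auto
    next
      case False
      then show ?thesis using less.prems card_le_rank_of[OF assms(1) less.prems] by auto
    qed
  qed
  then show thesis using that by blast
qed

lemma rank_of_mono:
  assumes "is_matroid M" "A \<subseteq> B"
  shows "rank_of M A \<le> rank_of M B"
  by (metis assms card_le_rank_of order_trans rank_of_basis)

lemma rank_of_le_card:
  assumes "is_matroid M" "finite A"
  shows "rank_of M A \<le> card A"
  by (metis assms card_mono rank_of_basis)

lemma rank_of_indep:
  assumes "is_matroid M" "I \<in> indep M"
  shows "rank_of M I = card I"
  by (meson assms card_le_rank_of is_matroidD(4) le_antisym order_refl rank_of_le_card)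

lemma rank_of_empty: "is_matroid M \<Longrightarrow> rank_of M {} = 0"
  using rank_of_le_card[of M "{}"] by simp

section \<open>Contraction: independence and rank\<close>

lemma contraction_simps [simp]:
  "ground (contraction M F) = ground M - F"
  "ground (restriction M F) = F"
  by (simp_all add: contraction_def restriction_def)

text \<open>\<open>C \<inter> F\<close> is an independent subset of \<open>F\<close> that contains
  \<open>B\<close>, and \<open>B\<close> already has the largest possible size.\<close>

lemma basis_of_superset_Int:
  assumes "is_matroid M" "B \<subseteq> F" "card B = rank_of M F" "C \<in> indep M" "B \<subseteq> C"
  shows "C \<inter> F = B"
proof -
  have "C \<inter> F \<in> indep M" using is_matroidD(5)[OF assms(1,4)] by auto
  then have "card (C \<inter> F) \<le> card B" "finite (C \<inter> F)"
    using card_le_rank_of[OF assms(1)] is_matroidD(4)[OF assms(1)] assms(3) by auto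
  then show ?thesis using assms(2,5) card_seteq[of "C \<inter> F" B] by auto
qed

text \<open>Makes the choice of the basis \<open>B\<close> of \<open>F\<close> immaterial. Extend
  \<open>B\<close> to a basis \<open>C\<close> of \<open>I \<union> F\<close>: since
  \<open>C\<close> meets \<open>F\<close> only in \<open>B\<close>, the rest \<open>C - B\<close>
  lies in \<open>I\<close>, and counting shows that it is all of \<open>I\<close>.\<close>

lemma indep_Un_basis:
  assumes M: "is_matroid M" and B: "B \<in> indep M" "B \<subseteq> F" "card B = rank_of M F"
    and I: "finite I" "I \<inter> F = {}" "rank_of M (I \<union> F) = card I + rank_of M F"
  shows "I \<union> B \<in> indep M"
proof -
  obtain C where C: "C \<in> indep M" "B \<subseteq> C" "C \<subseteq> I \<union> F" "card C = rank_of M (I \<union> F)"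
    using indep_extends_to_basis[OF M B(1), of "I \<union> F"] B(2) by auto
  have CF: "C \<inter> F = B" using basis_of_superset_Int M B(2,3) C(1,2) .
  have fin: "finite C" using is_matroidD(4)[OF M C(1)] .
  have "card C = card (C - B) + card B"
    using fin C(2) by (metis card_Diff_subset card_mono finite_subset le_add_diff_inverse2)
  then have "card (C - B) = card I" using C(4) I(3) B(3) by simp
  moreover have "C - B \<subseteq> I" using C(3) CF by auto
  ultimately have "C - B = I" using I(1) card_subset_eq by blast
  then show ?thesis using C(1,2) by (metis Un_Diff_cancel2 sup.absorb1)
qed

lemma rank_of_Un_le:
  assumes M: "is_matroid M" and "finite I"
  shows "rank_of M (I \<union> F) \<le> card I + rank_of M F"
proof -
  obtain C where C: "C \<in> indep M" "C \<subseteq> I \<union> F" "card C = rank_of M (I \<union> F)"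
    using rank_of_basis[OF M] .
  have "card C \<le> card (C \<inter> I) + card (C \<inter> F)"
    using C(2) card_Un_le[of "C \<inter> I" "C \<inter> F"] by (simp add: Int_Un_distrib[symmetric] Int_absorb2)
  also have "card (C \<inter> I) \<le> card I" using assms(2) by (simp add: card_mono)
  also have "card (C \<inter> F) \<le> rank_of M F"
    using is_matroidD(5)[OF M C(1)] by (intro card_le_rank_of[OF M]) auto
  finally show ?thesis using C(3) by simp
qed

text \<open>Replaces the existential basis in the definition of \<open>contraction\<close> by a rank
  condition, the form in which independence in a contraction is computed from here on.\<close>

lemma indep_contraction_iff:
  assumes M: "is_matroid M"
  shows "I \<in> indep (contraction M F) \<longleftrightarrow>
    I \<subseteq> ground M - F \<and> rank_of M (I \<union> F) = card I + rank_of M F"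
proof
  assume "I \<in> indep (contraction M F)"
  then obtain B where I: "I \<subseteq> ground M - F"
    and B: "B \<in> indep M" "B \<subseteq> F" "card B = rank_of M F" "I \<union> B \<in> indep M"
    by (auto simp: contraction_def)
  have fin: "finite I" "finite B" using is_matroidD(4)[OF M B(4)] by auto
  have "card I + rank_of M F = card (I \<union> B)"
    using fin I B(2,3) by (subst card_Un_disjoint) auto
  also have "\<dots> \<le> rank_of M (I \<union> F)" using B by (intro card_le_rank_of[OF M]) auto
  finally show "I \<subseteq> ground M - F \<and> rank_of M (I \<union> F) = card I + rank_of M F"
    using rank_of_Un_le[OF M fin(1), of F] I by simp
next
  assume I: "I \<subseteq> ground M - F \<and> rank_of M (I \<union> F) = card I + rank_of M F"
  obtain B where B: "B \<in> indep M" "B \<subseteq> F" "card B = rank_of M F"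
    using rank_of_basis[OF M] .
  have "I \<union> B \<in> indep M"
    using I is_matroidD(1)[OF M] by (intro indep_Un_basis[OF M B]) (auto intro: finite_subset)
  then show "I \<in> indep (contraction M F)" using I B by (auto simp: contraction_def)
qed

lemma contraction_empty: "is_matroid M \<Longrightarrow> contraction M {} = M"
  by (rule matroid.expand)
    (auto simp: contraction_def rank_of_empty dest: is_matroidD intro!: bexI[of _ "{}"])

text \<open>For one fixed basis \<open>B\<close> of \<open>F\<close>, independence of
  \<open>I\<close> means independence of \<open>I \<union> B\<close> in \<open>M\<close>, so every
  axiom is inherited by adding \<open>B\<close>. An augmenting element lies outside \<open>B\<close>
  automatically.\<close>

lemma is_matroid_contraction:
  assumes M: "is_matroid M"
  shows "is_matroid (contraction M F)"
proof -
  obtain B where B: "B \<in> indep M" "B \<subseteq> F" "card B = rank_of M F"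
    using rank_of_basis[OF M] .
  have indep: "I \<in> indep (contraction M F) \<longleftrightarrow> I \<subseteq> ground M - F \<and> I \<union> B \<in> indep M" for I
  proof
    assume "I \<in> indep (contraction M F)"
    then have "I \<subseteq> ground M - F" "rank_of M (I \<union> F) = card I + rank_of M F"
      using indep_contraction_iff[OF M] by auto
    moreover from this have "I \<union> B \<in> indep M"
      using is_matroidD(1)[OF M] by (intro indep_Un_basis[OF M B]) (auto intro: finite_subset)
    ultimately show "I \<subseteq> ground M - F \<and> I \<union> B \<in> indep M" by auto
  qed (use B in \<open>auto simp: contraction_def\<close>)
  have card: "card (I \<union> B) = card I + card B" if "I \<subseteq> ground M - F" for I
    using that B(2) is_matroidD(1)[OF M] is_matroidD(4)[OF M B(1)]
    by (subst card_Un_disjoint) (auto intro: finite_subset)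
  show ?thesis
    unfolding is_matroid_def
  proof (intro conjI ballI allI impI)
    show "finite (ground (contraction M F))" using is_matroidD(1)[OF M] by simp
    show "indep (contraction M F) \<subseteq> Pow (ground (contraction M F))" using indep by auto
    show "{} \<in> indep (contraction M F)" using indep B by auto
    show "J \<in> indep (contraction M F)" if "I \<in> indep (contraction M F)" "J \<subseteq> I" for I J
      using that is_matroidD(5)[OF M, of "I \<union> B" "J \<union> B"] unfolding indep by auto
    show "\<exists>x\<in>J - I. insert x I \<in> indep (contraction M F)"
      if "I \<in> indep (contraction M F)" "J \<in> indep (contraction M F)" "card I < card J" for I J
    proof -
      have "\<exists>x\<in>(J \<union> B) - (I \<union> B). insert x (I \<union> B) \<in> indep M"
        using that card by (intro is_matroidD(6)[OF M]) (auto simp: indep)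
      then show ?thesis using that unfolding indep by auto
    qed
  qed
qed

text \<open>The upper bound is the rank condition for a basis of \<open>A\<close>. For the lower
  bound, a basis of \<open>F\<close> is extended to a basis of \<open>A \<union> F\<close>, and the
  added elements are independent in the contraction.\<close>

lemma rank_of_contraction:
  assumes M: "is_matroid M" and A: "A \<subseteq> ground M - F"
  shows "rank_of (contraction M F) A = rank_of M (A \<union> F) - rank_of M F"
proof (rule antisym)
  obtain I where I: "I \<in> indep (contraction M F)" "I \<subseteq> A" "card I = rank_of (contraction M F) A"
    using rank_of_basis[OF is_matroid_contraction[OF M]] .
  then have "card I = rank_of M (I \<union> F) - rank_of M F"
    using indep_contraction_iff[OF M] by auto
  also have "\<dots> \<le> rank_of M (A \<union> F) - rank_of M F"
    using I(2) by (intro diff_le_mono rank_of_mono[OF M]) auto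
  finally show "rank_of (contraction M F) A \<le> rank_of M (A \<union> F) - rank_of M F"
    using I(3) by simp
next
  obtain B where B: "B \<in> indep M" "B \<subseteq> F" "card B = rank_of M F"
    using rank_of_basis[OF M] .
  obtain C where C: "C \<in> indep M" "B \<subseteq> C" "C \<subseteq> A \<union> F" "card C = rank_of M (A \<union> F)"
    using indep_extends_to_basis[OF M B(1), of "A \<union> F"] B(2) by auto
  have CF: "C \<inter> F = B" using basis_of_superset_Int M B(2,3) C(1,2) .
  have "C - B \<union> B = C" using C(2) by auto
  then have "C - B \<in> indep (contraction M F)"
    using A B C CF by (auto simp: contraction_def)
  then have "card (C - B) \<le> rank_of (contraction M F) A"
    using C(3) CF by (intro card_le_rank_of is_matroid_contraction M) auto
  then show "rank_of M (A \<union> F) - rank_of M F \<le> rank_of (contraction M F) A"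
    using B(3) C(2,4) is_matroidD(4)[OF M B(1)] by (simp add: card_Diff_subset)
qed

lemma rk_contraction:
  assumes "is_matroid M" "F \<subseteq> ground M"
  shows "rk (contraction M F) = rk M - rank_of M F"
  using rank_of_contraction[OF assms(1), of "ground M - F" F] assms(2)
  by (simp add: rk_def Un_absorb2)

text \<open>Ranks in the contraction are ranks of sets containing \<open>F\<close>, all lowered by
  the same constant, so adding \<open>x\<close> raises one exactly when it raises the other.\<close>

lemma flats_contraction:
  assumes M: "is_matroid M" and F: "F \<subseteq> ground M"
  shows "H \<in> flats (contraction M F) \<longleftrightarrow> H \<subseteq> ground M - F \<and> H \<union> F \<in> flats M"
proof -
  have "rank_of (contraction M F) H < rank_of (contraction M F) (insert x H) \<longleftrightarrow>
      rank_of M (H \<union> F) < rank_of M (insert x (H \<union> F))"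
    if "H \<subseteq> ground M - F" "x \<in> ground M - (H \<union> F)" for x
  proof -
    \<comment> \<open>Subtraction on \<open>nat\<close> is truncated; these bounds make it preserve
      and reflect strict inequality.\<close>
    have "rank_of M F \<le> rank_of M (H \<union> F)" by (intro rank_of_mono M) auto
    moreover have "rank_of M F \<le> rank_of M (insert x (H \<union> F))" by (intro rank_of_mono M) auto
    moreover have "rank_of (contraction M F) H = rank_of M (H \<union> F) - rank_of M F"
      using that by (intro rank_of_contraction M) auto
    moreover have "rank_of (contraction M F) (insert x H) = rank_of M (insert x H \<union> F) - rank_of M F"
      using that by (intro rank_of_contraction M) auto
    ultimately show ?thesis by auto
  qed
  moreover have "ground M - F - H = ground M - (H \<union> F)" by auto
  ultimately show ?thesis using F unfolding flats_def by auto
qed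

section \<open>Flats, loops and iterated contraction\<close>

lemma flats_subset: "F \<in> flats M \<Longrightarrow> F \<subseteq> ground M"
  by (simp add: flats_def)

lemma ground_in_flats: "ground M \<in> flats M"
  by (simp add: flats_def)

lemma finite_flats: "is_matroid M \<Longrightarrow> finite (flats M)"
  by (rule finite_subset[of _ "Pow (ground M)"]) (auto dest: is_matroidD flats_subset)

lemma loopless_contraction:
  assumes M: "is_matroid M" and F: "F \<in> flats M"
  shows "loopless (contraction M F)"
  unfolding loopless_def
proof
  fix x assume x: "x \<in> ground (contraction M F)"
  then have "rank_of M F < rank_of M (insert x F)" using F by (simp add: flats_def)
  then show "{x} \<in> indep (contraction M F)"
    using rank_of_Un_le[OF M, of "{x}" F] x by (auto simp: indep_contraction_iff[OF M])
qed

lemma empty_in_flats: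
  assumes "is_matroid M" "loopless M"
  shows "{} \<in> flats M"
  using assms rank_of_indep[OF assms(1)] by (auto simp: flats_def loopless_def rank_of_empty)

text \<open>The rank differences telescope: on both sides independence of \<open>I\<close> says that
  the rank of \<open>I \<union> G\<close> exceeds the rank of \<open>G\<close> by
  \<open>card I\<close>.\<close>

lemma contraction_contraction:
  assumes M: "is_matroid M" and "F \<subseteq> G" "G \<subseteq> ground M"
  shows "contraction (contraction M F) (G - F) = contraction M G"
proof -
  have g: "ground (contraction (contraction M F) (G - F)) = ground (contraction M G)"
    using assms by auto
  have "I \<in> indep (contraction (contraction M F) (G - F)) \<longleftrightarrow> I \<in> indep (contraction M G)" for I
  proof (cases "I \<subseteq> ground M - G")
    case True
    have eq: "I \<union> (G - F) \<union> F = I \<union> G" "G - F \<union> F = G" using assms by auto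
    have "rank_of (contraction M F) (I \<union> (G - F)) = rank_of M (I \<union> G) - rank_of M F"
      using rank_of_contraction[OF M, of "I \<union> (G - F)" F] True assms eq by auto
    moreover have "rank_of (contraction M F) (G - F) = rank_of M G - rank_of M F"
      using rank_of_contraction[OF M, of "G - F" F] assms eq by auto
    moreover have "rank_of M F \<le> rank_of M G" "rank_of M G \<le> rank_of M (I \<union> G)"
      using assms by (auto intro: rank_of_mono)
    ultimately show ?thesis
      using g by (auto simp: indep_contraction_iff is_matroid_contraction M)
  next
    case False
    then show ?thesis using g by (auto simp: indep_contraction_iff is_matroid_contraction M)
  qed
  then show ?thesis using g by (intro matroid.expand) auto
qed

section \<open>Restriction to a flat\<close>

lemma rank_of_restriction: "A \<subseteq> F \<Longrightarrow> rank_of (restriction M F) A = rank_of M A"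
  unfolding rank_of_def restriction_def by (auto intro!: arg_cong[of _ _ Max] arg_cong[of _ _ "image card"])

lemma rk_restriction: "rk (restriction M F) = rank_of M F"
  by (simp add: rk_def rank_of_restriction)

text \<open>Extend a basis \<open>B\<close> of \<open>G\<close> to a basis \<open>C\<close> of
  \<open>F\<close>, and \<open>C\<close> to a basis \<open>D\<close> of \<open>insert x F\<close>.
  As \<open>F\<close> is a flat, \<open>D\<close> is too large to lie in \<open>F\<close>, so it
  contains \<open>x\<close>, and \<open>insert x B\<close> is independent.\<close>

lemma rank_of_insert_subset_flat:
  assumes M: "is_matroid M" and F: "F \<in> flats M" "x \<in> ground M - F" and "G \<subseteq> F"
  shows "rank_of M G < rank_of M (insert x G)"
proof -
  obtain B where B: "B \<in> indep M" "B \<subseteq> G" "card B = rank_of M G"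
    using rank_of_basis[OF M] .
  obtain C where C: "C \<in> indep M" "B \<subseteq> C" "C \<subseteq> F" "card C = rank_of M F"
    using indep_extends_to_basis[OF M B(1), of F] B(2) assms(4) by auto
  obtain D where D: "D \<in> indep M" "C \<subseteq> D" "D \<subseteq> insert x F" "card D = rank_of M (insert x F)"
    using indep_extends_to_basis[OF M C(1), of "insert x F"] C(3) by auto
  have "rank_of M F < card D" using D(4) F by (simp add: flats_def)
  then have "\<not> D \<subseteq> F" using card_le_rank_of[OF M D(1), of F] by auto
  then have "insert x B \<in> indep M" using D B(2) C by (intro is_matroidD(5)[OF M D(1)]) auto
  then have "card (insert x B) \<le> rank_of M (insert x G)"
    using B(2) by (intro card_le_rank_of[OF M]) auto
  then show ?thesis using B assms is_matroidD(4)[OF M B(1)] by (auto simp: card_insert_if split: if_splits)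
qed

lemma flats_restriction:
  assumes "is_matroid M" "F \<in> flats M"
  shows "flats (restriction M F) = {G \<in> flats M. G \<subseteq> F}"
proof -
  have "rank_of M G < rank_of M (insert x G)"
    if "G \<in> flats (restriction M F)" "x \<in> ground M - G" for x G
  proof (cases "x \<in> F")
    case True
    then show ?thesis using that by (auto simp: flats_def rank_of_restriction)
  next
    case False
    then show ?thesis
      using that flats_subset[OF that(1)] by (intro rank_of_insert_subset_flat[OF assms]) auto
  qed
  then show ?thesis
    using flats_subset[OF assms(2)] by (auto simp: flats_def rank_of_restriction)
qed

section \<open>Moebius function and characteristic polynomials of minors\<close>

lemma moebius_refl [simp]: "moebius L X X = 1"
  by (simp add: moebius.simps)

lemma moebius_psubset:
  "finite L \<Longrightarrow> X \<subset> Y \<Longrightarrow> moebius L X Y = - (\<Sum>Z\<in>{Z \<in> L. X \<subseteq> Z \<and> Z \<subset> Y}. moebius L X Z)"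
  by (subst moebius.simps) auto

text \<open>\<open>moebius\<close> is defined by recursion on its upper argument; this is the dual
  identity, summed over the lower one. Unfolding \<open>moebius L F Y\<close> for all
  \<open>F\<close> below \<open>Y\<close> and swapping the sums leaves, by induction, only the term
  \<open>Z = X\<close>.\<close>

lemma sum_moebius_lower:
  assumes L: "finite L" and "X \<in> L" "Y \<in> L" "X \<subseteq> Y"
  shows "(\<Sum>F\<in>{F \<in> L. X \<subseteq> F \<and> F \<subseteq> Y}. moebius L F Y) = (if X = Y then 1 else 0)"
  using assms(3,4)
proof (induction "card {W \<in> L. W \<subset> Y}" arbitrary: Y rule: less_induct)
  case less
  show ?case
  proof (cases "X = Y")
    case True
    then have "{F \<in> L. X \<subseteq> F \<and> F \<subseteq> Y} = {Y}" using less.prems by auto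
    then show ?thesis using True by simp
  next
    case False
    have IH: "(\<Sum>F\<in>{F \<in> L. X \<subseteq> F \<and> F \<subseteq> Z}. moebius L F Z) = (if X = Z then 1 else 0)"
      if "Z \<in> L" "X \<subseteq> Z" "Z \<subset> Y" for Z
      using that L by (intro less.hyps psubset_card_mono) auto
    have split: "{F \<in> L. X \<subseteq> F \<and> F \<subseteq> Y} = insert Y {F \<in> L. X \<subseteq> F \<and> F \<subset> Y}"
      using less.prems by auto
    have "(\<Sum>F\<in>{F \<in> L. X \<subseteq> F \<and> F \<subset> Y}. moebius L F Y) =
        (\<Sum>F\<in>{F \<in> L. X \<subseteq> F \<and> F \<subset> Y}. - (\<Sum>Z\<in>{Z \<in> L. F \<subseteq> Z \<and> Z \<subset> Y}. moebius L F Z))"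
      using L by (intro sum.cong refl moebius_psubset) auto
    also have "\<dots> = - (\<Sum>F\<in>{F \<in> L. X \<subseteq> F \<and> F \<subset> Y}. \<Sum>Z\<in>{Z \<in> {Z \<in> L. X \<subseteq> Z \<and> Z \<subset> Y}. F \<subseteq> Z}. moebius L F Z)"
      unfolding sum_negf by (intro arg_cong[of _ _ uminus] sum.cong) auto
    also have "\<dots> = - (\<Sum>Z\<in>{Z \<in> L. X \<subseteq> Z \<and> Z \<subset> Y}. \<Sum>F\<in>{F \<in> {F \<in> L. X \<subseteq> F \<and> F \<subset> Y}. F \<subseteq> Z}. moebius L F Z)"
      using L by (subst sum.swap_restrict) auto
    also have "\<dots> = - (\<Sum>Z\<in>{Z \<in> L. X \<subseteq> Z \<and> Z \<subset> Y}. if X = Z then 1 else 0)"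
    proof (intro arg_cong[of _ _ uminus] sum.cong refl)
      fix Z assume Z: "Z \<in> {Z \<in> L. X \<subseteq> Z \<and> Z \<subset> Y}"
      then have "{F \<in> {F \<in> L. X \<subseteq> F \<and> F \<subset> Y}. F \<subseteq> Z} = {F \<in> L. X \<subseteq> F \<and> F \<subseteq> Z}" by auto
      then show "(\<Sum>F\<in>{F \<in> {F \<in> L. X \<subseteq> F \<and> F \<subset> Y}. F \<subseteq> Z}. moebius L F Z) = (if X = Z then 1 else 0)"
        using IH Z by simp
    qed
    also have "\<dots> = - 1" using False less.prems L assms(2) by simp
    finally show ?thesis using False L by (simp add: split)
  qed
qed

text \<open>Moebius values depend only on the interval, and removing \<open>F\<close> is an order
  isomorphism from the sets between \<open>F\<close> and \<open>G\<close> onto their image.\<close>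

lemma moebius_Diff_image:
  assumes "finite L" "K \<in> L" "F \<subseteq> K" "K \<subseteq> G"
  shows "moebius ((\<lambda>K. K - F) ` {K \<in> L. F \<subseteq> K \<and> K \<subseteq> G}) {} (K - F) = moebius L F K"
    (is "moebius ?L' _ _ = _")
  using assms(2-4)
proof (induction "card {W \<in> L. W \<subset> K}" arbitrary: K rule: less_induct)
  case less
  show ?case
  proof (cases "F = K")
    case False
    have inj: "inj_on (\<lambda>K. K - F) {Z \<in> L. F \<subseteq> Z \<and> Z \<subset> K}"
      by (auto simp: inj_on_def)
    have eq: "{Z \<in> ?L'. {} \<subseteq> Z \<and> Z \<subset> K - F} = (\<lambda>K. K - F) ` {Z \<in> L. F \<subseteq> Z \<and> Z \<subset> K}"
    proof (intro set_eqI iffI)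
      fix Z assume "Z \<in> {Z \<in> ?L'. {} \<subseteq> Z \<and> Z \<subset> K - F}"
      then obtain Y where "Z = Y - F" "Y \<in> L" "F \<subseteq> Y" "Y - F \<subset> K - F" by auto
      moreover from this have "Y \<in> {Z \<in> L. F \<subseteq> Z \<and> Z \<subset> K}" using less.prems by blast
      ultimately show "Z \<in> (\<lambda>K. K - F) ` {Z \<in> L. F \<subseteq> Z \<and> Z \<subset> K}" by blast
    next
      fix Z assume "Z \<in> (\<lambda>K. K - F) ` {Z \<in> L. F \<subseteq> Z \<and> Z \<subset> K}"
      then obtain Y where "Z = Y - F" "Y \<in> L" "F \<subseteq> Y" "Y \<subset> K" by blast
      moreover from this have "Y \<in> {K \<in> L. F \<subseteq> K \<and> K \<subseteq> G}" "Y - F \<subset> K - F"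
        using less.prems by blast+
      ultimately show "Z \<in> {Z \<in> ?L'. {} \<subseteq> Z \<and> Z \<subset> K - F}" by blast
    qed
    have IH: "moebius ?L' {} (Z - F) = moebius L F Z" if "Z \<in> L" "F \<subseteq> Z" "Z \<subset> K" for Z
    proof (rule less.hyps)
      show "card {W \<in> L. W \<subset> Z} < card {W \<in> L. W \<subset> K}"
        using that assms(1) by (intro psubset_card_mono) auto
    qed (use that less.prems in auto)
    have "moebius ?L' {} (K - F) = - (\<Sum>Z\<in>{Z \<in> L. F \<subseteq> Z \<and> Z \<subset> K}. moebius ?L' {} (Z - F))"
    proof -
      have "finite ?L'" using assms(1) by simp
      moreover have "{} \<subset> K - F" using False less.prems by auto
      ultimately show ?thesis
        using moebius_psubset[of ?L' "{}" "K - F"] unfolding eq sum.reindex[OF inj] by (simp add: o_def)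
    qed
    also have "\<dots> = - (\<Sum>Z\<in>{Z \<in> L. F \<subseteq> Z \<and> Z \<subset> K}. moebius L F Z)"
      using IH by simp
    also have "\<dots> = moebius L F K"
      using False less.prems assms(1) by (subst moebius_psubset) auto
    finally show ?thesis .
  qed simp
qed

section \<open>Characteristic polynomials of interval minors\<close>

lemma flats_contraction_image:
  assumes M: "is_matroid M" and F: "F \<subseteq> ground M"
  shows "flats (contraction M F) = (\<lambda>G. G - F) ` {G \<in> flats M. F \<subseteq> G}"
proof (intro set_eqI iffI)
  fix K assume "K \<in> flats (contraction M F)"
  then have "K \<union> F \<in> {G \<in> flats M. F \<subseteq> G}" "K = K \<union> F - F"
    using flats_contraction[OF M F] by auto
  then show "K \<in> (\<lambda>G. G - F) ` {G \<in> flats M. F \<subseteq> G}" by blast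
next
  fix K assume "K \<in> (\<lambda>G. G - F) ` {G \<in> flats M. F \<subseteq> G}"
  then show "K \<in> flats (contraction M F)"
    using flats_subset by (fastforce simp: flats_contraction[OF M F] Un_absorb2)
qed

lemma flats_minor:
  assumes M: "is_matroid M" and F: "F \<in> flats M" and G: "G \<in> flats M" and "F \<subseteq> G"
  shows "flats (restriction (contraction M F) (G - F)) =
    (\<lambda>K. K - F) ` {K \<in> flats M. F \<subseteq> K \<and> K \<subseteq> G}"
proof -
  have FG: "F \<subseteq> ground M" "G \<subseteq> ground M" using F G flats_subset by auto
  have "G - F \<in> flats (contraction M F)"
    using G FG assms(4) by (auto simp: flats_contraction[OF M FG(1)] Un_absorb2)
  then have "flats (restriction (contraction M F) (G - F)) = {K \<in> flats (contraction M F). K \<subseteq> G - F}"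
    by (intro flats_restriction is_matroid_contraction M)
  also have "\<dots> = (\<lambda>K. K - F) ` {K \<in> flats M. F \<subseteq> K \<and> K \<subseteq> G}"
    unfolding flats_contraction_image[OF M FG(1)] using assms(4) by blast
  finally show ?thesis .
qed

text \<open>Expresses the characteristic polynomials of all interval minors through the one Moebius
  function of \<open>flats M\<close>, so that sums over intervals can be interchanged.\<close>

lemma char_poly_minor:
  assumes M: "is_matroid M" and F: "F \<in> flats M" and G: "G \<in> flats M" and FG: "F \<subseteq> G"
  shows "char_poly (restriction (contraction M F) (G - F)) =
    (\<Sum>K\<in>{K \<in> flats M. F \<subseteq> K \<and> K \<subseteq> G}. monom (moebius (flats M) F K) (rank_of M G - rank_of M K))"
proof -
  let ?I = "{K \<in> flats M. F \<subseteq> K \<and> K \<subseteq> G}"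
  let ?N = "restriction (contraction M F) (G - F)"
  note flats = flats_minor[OF assms]
  have rank: "rank_of ?N (K - F) = rank_of M K - rank_of M F" if "F \<subseteq> K" "K \<subseteq> G" for K
  proof -
    have "rank_of ?N (K - F) = rank_of (contraction M F) (K - F)"
      using that by (intro rank_of_restriction) auto
    also have "\<dots> = rank_of M (K - F \<union> F) - rank_of M F"
      using that flats_subset[OF G] by (intro rank_of_contraction[OF M]) auto
    also have "K - F \<union> F = K" using that by auto
    finally show ?thesis .
  qed
  have "rk ?N = rank_of M G - rank_of M F" using rank[of G] FG by (simp add: rk_def)
  \<comment> \<open>The empty set is the image of \<open>F\<close> itself; hence the bottom element
    that \<open>char_poly\<close> refers to is \<open>{}\<close>.\<close>
  moreover have "{} \<in> flats ?N" unfolding flats using F FG by force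
  then have "\<Inter>(flats ?N) = {}" by auto
  ultimately have "char_poly ?N = (\<Sum>H\<in>(\<lambda>K. K - F) ` ?I.
      monom (moebius ((\<lambda>K. K - F) ` ?I) {} H) (rank_of M G - rank_of M F - rank_of ?N H))"
    unfolding char_poly_def by (simp add: flats)
  also have "\<dots> = (\<Sum>K\<in>?I. monom (moebius ((\<lambda>K. K - F) ` ?I) {} (K - F))
      (rank_of M G - rank_of M F - rank_of ?N (K - F)))"
    by (subst sum.reindex) (auto simp: inj_on_def)
  also have "\<dots> = (\<Sum>K\<in>?I. monom (moebius (flats M) F K) (rank_of M G - rank_of M K))"
  proof (intro sum.cong refl)
    fix K assume "K \<in> ?I"
    then show "monom (moebius ((\<lambda>K. K - F) ` ?I) {} (K - F)) (rank_of M G - rank_of M F - rank_of ?N (K - F)) =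
        monom (moebius (flats M) F K) (rank_of M G - rank_of M K)"
      using rank_of_mono[OF M, of F K] rank[of K]
      by (simp add: moebius_Diff_image finite_flats[OF M])
  qed
  finally show ?thesis .
qed

text \<open>After swapping the sums the exponent no longer depends on \<open>F\<close>, and the sum
  of Moebius values over the lower argument vanishes unless \<open>K = {}\<close>. This is the
  inversion that turns the Kazhdan--Lusztig equation into a statement about
  \<open>Z\<close>.\<close>

lemma sum_char_poly_minor:
  assumes M: "is_matroid M" "loopless M" and G: "G \<in> flats M"
  shows "(\<Sum>F\<in>{F \<in> flats M. F \<subseteq> G}. char_poly (restriction (contraction M F) (G - F))) =
    monom 1 (rank_of M G)"
proof -
  let ?L = "flats M" and ?r = "rank_of M"
  let ?D = "{F \<in> ?L. F \<subseteq> G}"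
  have fin: "finite ?D" using finite_flats[OF M(1)] by auto
  have "(\<Sum>F\<in>?D. char_poly (restriction (contraction M F) (G - F))) =
      (\<Sum>F\<in>?D. \<Sum>K\<in>{K \<in> ?D. F \<subseteq> K}. monom (moebius ?L F K) (?r G - ?r K))"
    using G by (auto simp: char_poly_minor[OF M(1)] intro!: sum.cong)
  also have "\<dots> = (\<Sum>K\<in>?D. \<Sum>F\<in>{F \<in> ?D. F \<subseteq> K}. monom (moebius ?L F K) (?r G - ?r K))"
    by (rule sum.swap_restrict[OF fin fin])
  also have "\<dots> = (\<Sum>K\<in>?D. if K = {} then monom 1 (?r G) else 0)"
  proof (intro sum.cong refl)
    fix K assume K: "K \<in> ?D"
    have "{F \<in> ?D. F \<subseteq> K} = {F \<in> ?L. {} \<subseteq> F \<and> F \<subseteq> K}" using K by auto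
    moreover have "(\<Sum>F\<in>{F \<in> ?L. {} \<subseteq> F \<and> F \<subseteq> K}. moebius ?L F K) = (if {} = K then 1 else 0)"
      using K empty_in_flats[OF M] finite_flats[OF M(1)] by (intro sum_moebius_lower) auto
    ultimately have "(\<Sum>F\<in>{F \<in> ?D. F \<subseteq> K}. moebius ?L F K) = (if {} = K then 1 else 0)"
      by simp
    moreover have "(\<Sum>F\<in>{F \<in> ?D. F \<subseteq> K}. monom (moebius ?L F K) (?r G - ?r K)) =
        monom (\<Sum>F\<in>{F \<in> ?D. F \<subseteq> K}. moebius ?L F K) (?r G - ?r K)"
      by (rule poly_eqI) (simp add: coeff_sum)
    ultimately show "(\<Sum>F\<in>{F \<in> ?D. F \<subseteq> K}. monom (moebius ?L F K) (?r G - ?r K)) =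
        (if K = {} then monom 1 (?r G) else 0)"
      using rank_of_empty[OF M(1)] by auto
  qed
  also have "\<dots> = monom 1 (?r G)"
    using fin empty_in_flats[OF M] by (simp add: sum.delta)
  finally show ?thesis .
qed

section \<open>Palindromic Z-polynomials\<close>

text \<open>The actual degree of \<open>p\<close> cancels between the two factors of
  \<open>rev_poly\<close>, so reversal becomes the reflection of indices at
  \<open>n\<close>.\<close>

lemma coeff_rev_poly:
  assumes "degree p \<le> n"
  shows "coeff (rev_poly n p) i = (if i \<le> n then coeff p (n - i) else 0)"
  using assms
  by (auto simp: rev_poly_def coeff_monom_mult coeff_reflect_poly coeff_eq_0 le_degree
      intro!: arg_cong[of _ _ "coeff p"])

lemma rev_poly_sum:
  assumes "\<And>x. x \<in> A \<Longrightarrow> degree (f x) \<le> n"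
  shows "rev_poly n (\<Sum>x\<in>A. f x) = (\<Sum>x\<in>A. rev_poly n (f x))"
proof -
  have "degree (\<Sum>x\<in>A. f x) \<le> n"
    using assms by (induction A rule: infinite_finite_induct) (auto intro: degree_add_le)
  then show ?thesis
    using assms by (intro poly_eqI) (auto simp: coeff_rev_poly coeff_sum)
qed

lemma rev_poly_monom_mult:
  assumes "a \<le> n" "degree p \<le> n - a"
  shows "rev_poly n (monom 1 a * p) = rev_poly (n - a) p"
proof -
  have "degree (monom 1 a * p) \<le> n"
    using assms degree_mult_le[of "monom 1 a" p] by (simp add: degree_monom_eq)
  then show ?thesis
    using assms by (intro poly_eqI) (auto simp: coeff_rev_poly coeff_monom_mult coeff_eq_0 add.commute)
qed

section \<open>The defining equation as palindromicity of \<open>Z\<close>\<close>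

lemma degree_monom_mult_contraction_le:
  fixes p :: "int poly"
  assumes M: "is_matroid M" and F: "F \<in> flats M" and p: "degree p \<le> rk (contraction M F)"
  shows "degree (monom 1 (rank_of M F) * p) \<le> rk M"
  using degree_mult_le[of "monom 1 (rank_of M F)" p] p rk_contraction[OF M flats_subset[OF F]]
    rank_of_mono[OF M flats_subset[OF F]]
  by (simp add: degree_monom_eq rk_def)

text \<open>The equation at a single matroid, so that it can be assumed for the proper contractions
  only.\<close>

definition KL_eq :: "('a matroid \<Rightarrow> int poly) \<Rightarrow> 'a matroid \<Rightarrow> bool" where
  "KL_eq P M \<longleftrightarrow> rev_poly (rk M) (P M) =
     (\<Sum>F\<in>flats M. char_poly (restriction M F) * P (contraction M F))"

text \<open>The \<open>Z\<close>-polynomial for an arbitrary candidate \<open>P\<close>, available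
  before existence and uniqueness are known.\<close>

definition Z_of :: "('a matroid \<Rightarrow> int poly) \<Rightarrow> 'a matroid \<Rightarrow> int poly" where
  "Z_of P M = (\<Sum>F\<in>flats M. monom 1 (rank_of M F) * P (contraction M F))"

text \<open>Reversing \<open>Z\<close> termwise and applying the Kazhdan--Lusztig equation to the terms with \<open>F \<noteq> {}\<close>
  gives \<open>Z\<close> back, up to the two sides of the equation at \<open>M\<close> itself.\<close>

lemma KL_eq_iff_Z_palindromic:
  assumes M: "is_matroid M" "loopless M"
    and deg: "\<And>F. F \<in> flats M \<Longrightarrow> degree (P (contraction M F)) \<le> rk (contraction M F)"
    and KL: "\<And>F. F \<in> flats M \<Longrightarrow> F \<noteq> {} \<Longrightarrow> KL_eq P (contraction M F)"
  shows "KL_eq P M \<longleftrightarrow> rev_poly (rk M) (Z_of P M) = Z_of P M"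
proof -
  let ?L = "flats M"
  let ?chi = "\<lambda>F G. char_poly (restriction (contraction M F) (G - F))"
  note fin = finite_flats[OF M(1)] and empty = empty_in_flats[OF M]
  have rk_le: "rank_of M F \<le> rk M" if "F \<in> ?L" for F
    unfolding rk_def using that flats_subset by (intro rank_of_mono M)
  have degF: "degree (P (contraction M F)) \<le> rk M - rank_of M F" if "F \<in> ?L" for F
    using deg[OF that] rk_contraction[OF M(1) flats_subset[OF that]] by simp
  have KL_F: "rev_poly (rk M - rank_of M F) (P (contraction M F)) =
      (\<Sum>G\<in>{G \<in> ?L. F \<subseteq> G}. ?chi F G * P (contraction M G))" if F: "F \<in> ?L" "F \<noteq> {}" for F
  proof -
    have FE: "F \<subseteq> ground M" using F flats_subset by auto
    have "rev_poly (rk M - rank_of M F) (P (contraction M F)) =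
        (\<Sum>H\<in>flats (contraction M F). char_poly (restriction (contraction M F) H) *
           P (contraction (contraction M F) H))"
      using KL[OF F] rk_contraction[OF M(1) FE] by (simp add: KL_eq_def)
    also have "\<dots> = (\<Sum>G\<in>{G \<in> ?L. F \<subseteq> G}. ?chi F G * P (contraction (contraction M F) (G - F)))"
      unfolding flats_contraction_image[OF M(1) FE] by (subst sum.reindex) (auto simp: inj_on_def)
    also have "\<dots> = (\<Sum>G\<in>{G \<in> ?L. F \<subseteq> G}. ?chi F G * P (contraction M G))"
      by (intro sum.cong refl) (auto simp: contraction_contraction[OF M(1)] dest: flats_subset)
    finally show ?thesis .
  qed
  have "rev_poly (rk M) (Z_of P M) = (\<Sum>F\<in>?L. rev_poly (rk M) (monom 1 (rank_of M F) * P (contraction M F)))"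
    unfolding Z_of_def
    by (intro rev_poly_sum degree_monom_mult_contraction_le M deg)
  also have "\<dots> = (\<Sum>F\<in>?L. rev_poly (rk M - rank_of M F) (P (contraction M F)))"
    by (intro sum.cong refl rev_poly_monom_mult rk_le degF)
  also have "\<dots> = rev_poly (rk M) (P M) + (\<Sum>F\<in>?L - {{}}. rev_poly (rk M - rank_of M F) (P (contraction M F)))"
    using fin empty by (subst sum.remove[of _ "{}"]) (auto simp: contraction_empty M rank_of_empty)
  also have "(\<Sum>F\<in>?L - {{}}. rev_poly (rk M - rank_of M F) (P (contraction M F))) =
      (\<Sum>F\<in>?L - {{}}. \<Sum>G\<in>{G \<in> ?L. F \<subseteq> G}. ?chi F G * P (contraction M G))"
    by (intro sum.cong refl KL_F) auto
  \<comment> \<open>The equation is not assumed at \<open>M\<close>, so the inner sum for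
    \<open>F = {}\<close> is added and subtracted to complete the double sum.\<close>
  also have "\<dots> = (\<Sum>F\<in>?L. \<Sum>G\<in>{G \<in> ?L. F \<subseteq> G}. ?chi F G * P (contraction M G)) -
      (\<Sum>G\<in>?L. ?chi {} G * P (contraction M G))"
    using fin empty by (subst (2) sum.remove[of _ "{}"]) auto
  also have "(\<Sum>F\<in>?L. \<Sum>G\<in>{G \<in> ?L. F \<subseteq> G}. ?chi F G * P (contraction M G)) =
      (\<Sum>G\<in>?L. \<Sum>F\<in>{F \<in> ?L. F \<subseteq> G}. ?chi F G * P (contraction M G))"
    by (rule sum.swap_restrict[OF fin fin])
  also have "\<dots> = Z_of P M"
    unfolding Z_of_def
    by (intro sum.cong refl) (simp add: sum_distrib_right[symmetric] sum_char_poly_minor[OF M])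
  finally have "rev_poly (rk M) (Z_of P M) =
      rev_poly (rk M) (P M) + (Z_of P M - (\<Sum>G\<in>?L. ?chi {} G * P (contraction M G)))" .
  then show ?thesis
    by (auto simp: KL_eq_def contraction_empty M algebra_simps)
qed

text \<open>Contractions by flats are again loopless matroids, which gives one direction at once.
  The converse is by induction on the size of the ground set, which a nonempty flat strictly
  lowers.\<close>

lemma KL_assignment_iff:
  "KL_assignment P \<longleftrightarrow> (\<forall>M. is_matroid M \<and> loopless M \<longrightarrow>
     (rk M = 0 \<longrightarrow> P M = 1) \<and> (rk M > 0 \<longrightarrow> 2 * degree (P M) < rk M) \<and>
     rev_poly (rk M) (Z_of P M) = Z_of P M)"
proof
  assume P: "KL_assignment P"
  then have KL: "KL_eq P M" and deg: "degree (P M) \<le> rk M" if "is_matroid M" "loopless M" for M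
    using that unfolding KL_assignment_def KL_eq_def by (cases "rk M = 0"; force)+
  then have "rev_poly (rk M) (Z_of P M) = Z_of P M" if "is_matroid M" "loopless M" for M
    using that
    by (subst KL_eq_iff_Z_palindromic[symmetric]) (auto simp: is_matroid_contraction loopless_contraction)
  then show "\<forall>M. is_matroid M \<and> loopless M \<longrightarrow>
     (rk M = 0 \<longrightarrow> P M = 1) \<and> (rk M > 0 \<longrightarrow> 2 * degree (P M) < rk M) \<and>
     rev_poly (rk M) (Z_of P M) = Z_of P M"
    using P by (auto simp: KL_assignment_def)
next
  assume P: "\<forall>M. is_matroid M \<and> loopless M \<longrightarrow>
     (rk M = 0 \<longrightarrow> P M = 1) \<and> (rk M > 0 \<longrightarrow> 2 * degree (P M) < rk M) \<and>
     rev_poly (rk M) (Z_of P M) = Z_of P M"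
  then have deg: "degree (P M) \<le> rk M" if "is_matroid M" "loopless M" for M
    using that by (cases "rk M = 0"; force)
  have "KL_eq P M" if "is_matroid M" "loopless M" for M
    using that
  proof (induction "card (ground M)" arbitrary: M rule: less_induct)
    case less
    have "KL_eq P (contraction M F)" if F: "F \<in> flats M" "F \<noteq> {}" for F
      using F less.prems flats_subset[OF F(1)] is_matroidD(1)[OF less.prems(1)]
      by (intro less.hyps is_matroid_contraction loopless_contraction)
        (auto intro!: psubset_card_mono)
    then show ?case
      using less.prems P deg
      by (subst KL_eq_iff_Z_palindromic) (auto simp: is_matroid_contraction loopless_contraction)
  qed
  then show "KL_assignment P" using P by (auto simp: KL_assignment_def KL_eq_def)
qed

section \<open>Existence and uniqueness of Kazhdan--Lusztig polynomials\<close>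

text \<open>\<open>Q\<close> is the part of the \<open>Z\<close>-polynomial that does not involve \<open>M\<close> itself; the lower half that makes
  it palindromic is forced.\<close>

function KL_rec :: "'a matroid \<Rightarrow> int poly" where
  "KL_rec M =
     (if is_matroid M \<and> rk M > 0 then
        let Q = (\<Sum>F\<in>flats M - {{}}. monom 1 (rank_of M F) * KL_rec (contraction M F))
        in (\<Sum>i | 2 * i < rk M. monom (coeff Q (rk M - i) - coeff Q i) i)
      else 1)"
  by pat_completeness auto
termination
proof (relation "measure (\<lambda>M. card (ground M))", goal_cases)
  case (2 M F)
  then show ?case
    using flats_subset[of F M] is_matroidD(1)[of M] by (auto intro!: psubset_card_mono)
qed simp

declare KL_rec.simps [simp del]

lemma Z_of_split:
  assumes "is_matroid M" "loopless M"
  shows "Z_of P M = P M + (\<Sum>F\<in>flats M - {{}}. monom 1 (rank_of M F) * P (contraction M F))"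
  unfolding Z_of_def using assms
  by (subst sum.remove[of _ "{}"])
    (auto simp: finite_flats empty_in_flats rank_of_empty contraction_empty monom_0)

lemma ground_eq_empty_if_rk_0:
  assumes M: "is_matroid M" "loopless M" and "rk M = 0"
  shows "ground M = {}"
proof (rule ccontr)
  assume "ground M \<noteq> {}"
  then obtain x where "x \<in> ground M" by auto
  then show False
    using card_le_rank_of[OF M(1), of "{x}" "ground M"] M(2) assms(3)
    by (auto simp: loopless_def rk_def)
qed

lemma KL_assignment_KL_rec: "KL_assignment KL_rec"
  unfolding KL_assignment_iff
proof (intro allI impI, elim conjE)
  fix M :: "'a matroid" assume "is_matroid M" "loopless M"
  then show "(rk M = 0 \<longrightarrow> KL_rec M = 1) \<and> (rk M > 0 \<longrightarrow> 2 * degree (KL_rec M) < rk M) \<and>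
     rev_poly (rk M) (Z_of KL_rec M) = Z_of KL_rec M"
  proof (induction "card (ground M)" arbitrary: M rule: less_induct)
    case less
    note M = less.prems
    define Q where "Q = (\<Sum>F\<in>flats M - {{}}. monom 1 (rank_of M F) * KL_rec (contraction M F))"
    have Z: "Z_of KL_rec M = KL_rec M + Q"
      unfolding Q_def by (rule Z_of_split[OF M])
    show ?case
    proof (cases "rk M = 0")
      case True
      then have "flats M = {{}}"
        using ground_eq_empty_if_rk_0[OF M] ground_in_flats[of M] flats_subset[of _ M] by auto
      then have "Q = 0" by (simp add: Q_def)
      then show ?thesis
        using True Z by (simp add: KL_rec.simps[of M] rev_poly_def)
    next
      case False
      let ?r = "rk M"
      have degQ: "degree Q \<le> ?r"
        unfolding Q_def
      proof (intro degree_sum_le)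
        fix F assume F: "F \<in> flats M - {{}}"
        then have FE: "F \<subseteq> ground M" using flats_subset by auto
        have "(rk (contraction M F) = 0 \<longrightarrow> KL_rec (contraction M F) = 1) \<and>
            (rk (contraction M F) > 0 \<longrightarrow> 2 * degree (KL_rec (contraction M F)) < rk (contraction M F)) \<and>
            rev_poly (rk (contraction M F)) (Z_of KL_rec (contraction M F)) = Z_of KL_rec (contraction M F)"
          using F FE M is_matroidD(1)[OF M(1)]
          by (intro less.hyps is_matroid_contraction loopless_contraction)
            (auto intro!: psubset_card_mono)
        then have "degree (KL_rec (contraction M F)) \<le> rk (contraction M F)"
          by (cases "rk (contraction M F) = 0") auto
        then show "degree (monom 1 (rank_of M F) * KL_rec (contraction M F)) \<le> ?r"
          using F by (intro degree_monom_mult_contraction_le M) auto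
      qed (use finite_flats[OF M(1)] in auto)
      have fin: "finite {i. 2 * i < ?r}" by (rule finite_subset[of _ "{..?r}"]) auto
      have c: "coeff (KL_rec M) i = (if 2 * i < ?r then coeff Q (?r - i) - coeff Q i else 0)" for i
        using False M(1) fin
        by (subst KL_rec.simps) (simp add: Q_def[symmetric] Let_def coeff_sum sum.delta)
      have "degree (KL_rec M) \<le> (?r - 1) div 2"
        using False by (intro degree_le) (auto simp: c)
      then have deg: "2 * degree (KL_rec M) < ?r" using False by linarith
      then have "degree (KL_rec M + Q) \<le> ?r" using degQ by (intro degree_add_le) auto
      \<comment> \<open>Neither index lies in the lower half, so this is the middle degree, which
        the reversal fixes.\<close>
      moreover have "coeff Q (?r - i) = coeff Q i" if "\<not> 2 * i < ?r" "\<not> 2 * (?r - i) < ?r" "i \<le> ?r" for i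
      proof -
        have "?r - i = i" using that by linarith
        then show ?thesis by simp
      qed
      ultimately have "rev_poly ?r (KL_rec M + Q) = KL_rec M + Q"
        using degQ by (intro poly_eqI) (auto simp: coeff_rev_poly c coeff_eq_0)
      then show ?thesis using deg False Z by simp
    qed
  qed
qed

text \<open>In the lower half both \<open>p\<close> and \<open>q\<close> have the coefficients
  \<open>coeff r (n - i) - coeff r i\<close>, and in the upper half both vanish.\<close>

lemma palindromic_diff_eq:
  assumes "2 * degree p < n" "2 * degree q < n" "degree r \<le> n"
    and "rev_poly n (p + r) = p + r" "rev_poly n (q + r) = q + r"
  shows "p = q"
proof (rule poly_eqI)
  fix i
  have d: "degree (p + r) \<le> n" "degree (q + r) \<le> n" using assms by (auto intro: degree_add_le)
  have *: "coeff p i + coeff r i = coeff p (n - i) + coeff r (n - i)"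
    "coeff q i + coeff r i = coeff q (n - i) + coeff r (n - i)" if "i \<le> n"
    using that arg_cong[OF assms(4), of "\<lambda>p. coeff p i"] arg_cong[OF assms(5), of "\<lambda>p. coeff p i"]
    by (simp_all add: coeff_rev_poly d)
  show "coeff p i = coeff q i"
  proof (cases "2 * i < n")
    case True
    then have "coeff p (n - i) = 0" "coeff q (n - i) = 0"
      using assms by (auto intro!: coeff_eq_0)
    then show ?thesis using * True by simp
  next
    case False
    then have "coeff p i = 0" "coeff q i = 0"
      using assms by (auto intro!: coeff_eq_0)
    then show ?thesis by simp
  qed
qed

text \<open>By induction \<open>P\<close> and \<open>Q\<close> agree on contractions by nonempty
  flats, so both complete the same remainder \<open>R\<close> to a palindromic polynomial.\<close>

lemma KL_assignment_unique:
  assumes P: "KL_assignment P" and Q: "KL_assignment Q" and "is_matroid M" "loopless M"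
  shows "P M = Q M"
  using assms(3,4)
proof (induction "card (ground M)" arbitrary: M rule: less_induct)
  case less
  note M = less.prems
  define R where "R = (\<Sum>F\<in>flats M - {{}}. monom 1 (rank_of M F) * P (contraction M F))"
  have "P (contraction M F) = Q (contraction M F)" if F: "F \<in> flats M - {{}}" for F
    using F M is_matroidD(1)[OF M(1)] flats_subset[of F M]
    by (intro less.hyps is_matroid_contraction loopless_contraction) (auto intro!: psubset_card_mono)
  then have Z: "Z_of P M = P M + R" "Z_of Q M = Q M + R"
    by (simp_all add: Z_of_split[OF M] R_def)
  show ?case
  proof (cases "rk M = 0")
    case True
    then show ?thesis using P Q M by (auto simp: KL_assignment_def)
  next
    case False
    have degP: "degree (P N) \<le> rk N" if "is_matroid N" "loopless N" for N
      using P that unfolding KL_assignment_def by (cases "rk N = 0"; force)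
    have "degree R \<le> rk M"
      unfolding R_def
      using M finite_flats[OF M(1)]
      by (intro degree_sum_le degree_monom_mult_contraction_le degP
          is_matroid_contraction loopless_contraction) auto
    then show ?thesis
      using False P Q M palindromic_diff_eq[of "P M" "rk M" "Q M" R]
      unfolding KL_assignment_iff Z[symmetric] by blast
  qed
qed

lemma KL_poly_eq:
  assumes "KL_assignment P" "is_matroid M" "loopless M"
  shows "KL_poly M = P M"
  unfolding KL_poly_def using assms KL_assignment_unique by (intro the_equality) blast+

text \<open>\<open>KL_poly\<close> is described value by value, so it has to be shown that the
  values fit together. They agree with \<open>KL_rec\<close> on loopless matroids, and the
  conditions only involve such values.\<close>

lemma KL_assignment_KL_poly: "KL_assignment KL_poly"
proof -
  have eq: "KL_poly M = KL_rec M" if "is_matroid M" "loopless M" for M :: "'a matroid"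
    using KL_poly_eq[OF KL_assignment_KL_rec that] .
  have "Z_of KL_poly M = Z_of KL_rec M" if "is_matroid M" "loopless M" for M :: "'a matroid"
    unfolding Z_of_def using that
    by (intro sum.cong refl) (simp add: eq is_matroid_contraction loopless_contraction)
  then show ?thesis
    using KL_assignment_KL_rec eq unfolding KL_assignment_iff by simp
qed

lemma Z_poly_eq_Z_of: "Z_poly M = Z_of KL_poly M"
  by (simp add: Z_poly_def Z_of_def rk_restriction)

section \<open>The closed form\<close>

lemma alternating_sum_choose_Suc:
  fixes f :: "nat \<Rightarrow> real"
  shows "(\<Sum>k\<le>Suc n. (-1) ^ k * real (Suc n choose k) * f k) =
    (\<Sum>k\<le>n. (-1) ^ k * real (n choose k) * (f k - f (Suc k)))"
proof -
  \<comment> \<open>Pascal's rule splits the sum in two; this reduces the difference of order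
    \<open>Suc n\<close> of \<open>f\<close> to the one of order \<open>n\<close> of its first
    difference.\<close>
  have "(\<Sum>k\<le>Suc n. (-1) ^ k * real (Suc n choose k) * f k) =
      f 0 + (\<Sum>k\<le>n. (-1) ^ Suc k * real (n choose Suc k) * f (Suc k)) -
      (\<Sum>k\<le>n. (-1) ^ k * real (n choose k) * f (Suc k))"
    by (subst sum.atMost_Suc_shift) (simp add: algebra_simps sum.distrib sum_subtractf sum_negf)
  also have "f 0 + (\<Sum>k\<le>n. (-1) ^ Suc k * real (n choose Suc k) * f (Suc k)) =
      (\<Sum>k\<le>Suc n. (-1) ^ k * real (n choose k) * f k)"
    by (subst sum.atMost_Suc_shift) simp
  also have "\<dots> = (\<Sum>k\<le>n. (-1) ^ k * real (n choose k) * f k)" by simp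
  finally show ?thesis by (simp only: right_diff_distrib sum_subtractf)
qed

text \<open>The sum is an \<open>n\<close>-th difference of a polynomial in \<open>k\<close> of
  degree \<open>r < n\<close>. Each difference lowers the bottom index by one, by Pascal's
  rule.\<close>

lemma alternating_sum_choose_gbinomial:
  fixes x :: real
  assumes "r < n"
  shows "(\<Sum>k\<le>n. (-1) ^ k * real (n choose k) * (x - real k gchoose r)) = 0"
  using assms
proof (induction n arbitrary: x r)
  case (Suc n)
  show ?case
  proof (cases r)
    case 0
    then show ?thesis by (subst alternating_sum_choose_Suc) simp
  next
    case (Suc q)
    have "(x - real k gchoose Suc q) - (x - real (Suc k) gchoose Suc q) = (x - 1 - real k gchoose q)" for k
      using gbinomial_Suc_Suc[of "x - 1 - real k" q] by (simp add: algebra_simps)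
    then show ?thesis
      unfolding Suc alternating_sum_choose_Suc using Suc.IH[of q "x - 1"] Suc.prems Suc by simp
  qed
qed simp

section \<open>Symmetry of the alternating sum\<close>

text \<open>This is \<open>m\<close> times the sum in the closed form, with \<open>d - i\<close>
  replaced by an independent index \<open>j\<close>, so that its symmetry can be stated and proved
  by recursion.\<close>

definition zsum :: "nat \<Rightarrow> nat \<Rightarrow> nat \<Rightarrow> real" where
  "zsum m i j = (\<Sum>h=1..m. (-1) ^ (h + 1) * real h * (real (i + m) gchoose (m - h)) *
     (real j - real h + real m - 1 gchoose (m - 1)))"

text \<open>Applying Pascal's rule to both factors of each summand takes a difference in \<open>i\<close> and one in \<open>j\<close>,
  and lowers \<open>m\<close>. With the constant boundary values this forces symmetry in \<open>i\<close> and \<open>j\<close>.\<close>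

lemma zsum_recurrence:
  "zsum (Suc (Suc p)) (Suc i) (Suc j) =
     zsum (Suc (Suc p)) i (Suc j) + zsum (Suc (Suc p)) (Suc i) j - zsum (Suc (Suc p)) i j + zsum (Suc p) (Suc i) (Suc j)"
proof -
  let ?m = "Suc (Suc p)"
  let ?a = "\<lambda>i h. real (i + ?m) gchoose (?m - h)"
  let ?b = "\<lambda>j h. real j - real h + real ?m - 1 gchoose Suc p"
  have a: "?a (Suc i) h - ?a i h = (real (Suc i + Suc p) gchoose (Suc p - h))" if "h \<le> Suc p" for h
    using gbinomial_Suc_Suc[of "real (Suc i + Suc p)" "Suc p - h"] that
    by (simp add: Suc_diff_le algebra_simps)
  have b: "?b (Suc j) h - ?b j h = (real (Suc j) - real h + real (Suc p) - 1 gchoose p)" for h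
    using gbinomial_Suc_Suc[of "real j - real h + real (Suc p)" p] by (simp add: algebra_simps)
  have "zsum ?m (Suc i) (Suc j) - zsum ?m i (Suc j) - zsum ?m (Suc i) j + zsum ?m i j =
      (\<Sum>h=1..?m. (-1) ^ (h + 1) * real h * (?a (Suc i) h - ?a i h) * (?b (Suc j) h - ?b j h))"
    unfolding zsum_def sum_subtractf[symmetric] sum.distrib[symmetric] diff_Suc_1
    by (intro sum.cong refl) (simp only: algebra_simps)
  \<comment> \<open>For \<open>h = ?m\<close> the bottom index of \<open>?a\<close> is 0, so both
    values are 1 and the difference vanishes.\<close>
  also have "\<dots> = (\<Sum>h=1..Suc p. (-1) ^ (h + 1) * real h * (?a (Suc i) h - ?a i h) * (?b (Suc j) h - ?b j h))"
    by (subst sum.cl_ivl_Suc) simp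
  also have "\<dots> = zsum (Suc p) (Suc i) (Suc j)"
    unfolding zsum_def b diff_Suc_1 by (intro sum.cong refl) (subst a, auto)
  finally show ?thesis by simp
qed

text \<open>For \<open>h < m\<close> the top index \<open>m - 1 - h\<close> is a natural number
  below \<open>m - 1\<close>, so only \<open>h = m\<close> survives. Its factor, -1 over
  \<open>m - 1\<close>, cancels the sign.\<close>

lemma zsum_0_right:
  assumes "m > 0"
  shows "zsum m i 0 = real m"
proof -
  obtain p where p: "m = Suc p" using assms by (cases m) auto
  have "real p - real h gchoose p = 0" if "h \<in> {1..p}" for h
  proof -
    have "real p - real h = real (p - h)" "p - h < p" using that by auto
    then show ?thesis by (simp only: binomial_gbinomial[symmetric] binomial_eq_0 of_nat_0)
  qed
  then have "zsum m i 0 = (-1) ^ (m + 1) * real m * (- 1 gchoose p)"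
    unfolding zsum_def p by (subst sum.cl_ivl_Suc) (simp add: sum.neutral)
  then show ?thesis
    using gbinomial_minus[of "1::real" p] by (simp add: p binomial_gbinomial[symmetric])
qed

text \<open>The sum does not depend on \<open>j\<close>: since \<open>h * (m choose (m - h))\<close>
  equals \<open>m * (m - 1 choose (h - 1))\<close>, its first difference in \<open>j\<close> is an
  \<open>(m - 1)\<close>-st difference of a polynomial of degree \<open>m - 2\<close>.\<close>

lemma zsum_0_left:
  assumes "m > 0"
  shows "zsum m 0 j = real m"
proof (induction j)
  case 0
  show ?case using assms by (rule zsum_0_right)
next
  case (Suc j)
  obtain p where p: "m = Suc p" using assms by (cases m) auto
  have "zsum m 0 (Suc j) - zsum m 0 j = 0"
  proof (cases p)
    case 0
    then show ?thesis by (simp add: zsum_def p)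
  next
    case q: (Suc q)
    have b: "(real (Suc j) - real h + real m - 1 gchoose p) - (real j - real h + real m - 1 gchoose p) =
        (real j - real h + real m - 1 gchoose q)" for h
      using gbinomial_Suc_Suc[of "real j - real h + real m - 1" q] by (simp add: q algebra_simps)
    have a: "(real (0 + m) gchoose (m - h)) = real (m choose (m - h))" for h
      by (simp only: binomial_gbinomial add_0)
    have "zsum m 0 (Suc j) - zsum m 0 j = (\<Sum>h=1..m. (-1) ^ (h + 1) * (real h * real (m choose (m - h))) *
        ((real (Suc j) - real h + real m - 1 gchoose p) - (real j - real h + real m - 1 gchoose p)))"
      unfolding zsum_def sum_subtractf[symmetric] a
      by (intro sum.cong refl) (simp only: p diff_Suc_1 right_diff_distrib mult.assoc)
    also have "\<dots> = (\<Sum>k\<le>p. (-1) ^ k * (real (Suc k) * real (m choose (p - k))) *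
        (real j + real p - 1 - real k gchoose q))"
      unfolding b by (rule sym, rule sum.reindex_bij_witness[of _ "\<lambda>h. h - 1" Suc]) (auto simp: p algebra_simps)
    also have "\<dots> = real m * (\<Sum>k\<le>p. (-1) ^ k * real (p choose k) * (real j + real p - 1 - real k gchoose q))"
      unfolding sum_distrib_left
    proof (intro sum.cong refl)
      fix k assume k: "k \<in> {..p}"
      have "real (Suc k) * real (m choose (p - k)) = real m * real (p choose k)"
      proof -
        have "m choose (p - k) = m choose Suc k"
          using k binomial_symmetric[of "Suc k" m] by (simp add: p del: binomial_Suc_Suc)
        then show ?thesis
          using Suc_times_binomial[of k p] unfolding p of_nat_mult[symmetric] by metis
      qed
      then show "(-1) ^ k * (real (Suc k) * real (m choose (p - k))) * (real j + real p - 1 - real k gchoose q) =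
          real m * ((-1) ^ k * real (p choose k) * (real j + real p - 1 - real k gchoose q))"
        by (simp only: mult_ac)
    qed
    also have "\<dots> = 0" using q by (subst alternating_sum_choose_gbinomial) auto
    finally show ?thesis .
  qed
  then show ?case using Suc.IH by simp
qed

text \<open>Outer induction on \<open>m\<close>, where \<open>m = 1\<close> gives the constant 1;
  inner induction on \<open>i + j\<close>. The recurrence treats \<open>i\<close> and
  \<open>j\<close> alike, and the boundary values agree.\<close>

lemma zsum_commute:
  assumes "m > 0"
  shows "zsum m i j = zsum m j i"
  using assms
proof (induction m arbitrary: i j)
  case (Suc n)
  note IH = Suc.IH
  show ?case
  proof (cases n)
    case 0
    then show ?thesis by (simp add: zsum_def)
  next
    case p: (Suc p)
    show ?thesis
    proof (induction "i + j" arbitrary: i j rule: less_induct)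
      case less
      show ?case
      proof (cases "i = 0 \<or> j = 0")
        case True
        then show ?thesis by (auto simp: zsum_0_left zsum_0_right)
      next
        case False
        then obtain a b where [simp]: "i = Suc a" "j = Suc b" by (metis not0_implies_Suc)
        show ?thesis
          using less[of a j] less[of i b] less[of a b] IH[of i j]
          by (simp add: p zsum_recurrence)
      qed
    qed
  qed
qed simp

section \<open>The closed form and its binomial inverse\<close>

definition uniform_Z_coeff :: "nat \<Rightarrow> nat \<Rightarrow> nat \<Rightarrow> real" where
  "uniform_Z_coeff m d i = (real (d + 2 * m) gchoose (i + m)) * (real d gchoose i) / (real (d + 2 * m) gchoose m) *
     (\<Sum>h=1..m. (-1) ^ (h + 1) * real h / real m * (real (i + m) gchoose (m - h)) *
        ((real d - real i - real h + real m - 1) gchoose (m - 1)))"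

text \<open>Written with factorials, the prefactor is visibly symmetric in \<open>i\<close> and
  \<open>j\<close>, which leaves the symmetry of the closed form to \<open>zsum\<close>.\<close>

lemma uniform_Z_coeff_altdef:
  assumes "i + j = d" "m > 0"
  shows "uniform_Z_coeff m d i = fact d * fact (d + m) * fact m /
    (fact (i + m) * fact (j + m) * fact i * fact j) * (zsum m i j / real m)"
proof -
  have "(\<Sum>h=1..m. (-1) ^ (h + 1) * real h / real m * (real (i + m) gchoose (m - h)) *
        ((real d - real i - real h + real m - 1) gchoose (m - 1))) = zsum m i j / real m"
    unfolding zsum_def sum_divide_distrib using assms(1)
    by (intro sum.cong refl) (auto simp: field_simps)
  moreover have "(real (d + 2 * m) gchoose (i + m)) * (real d gchoose i) / (real (d + 2 * m) gchoose m) =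
      fact d * fact (d + m) * fact m / (fact (i + m) * fact (j + m) * fact i * fact j)"
  proof -
    have e1: "(real (d + 2 * m) gchoose (i + m)) = fact (d + 2 * m) / (fact (i + m) * fact (j + m))"
    proof -
      have "d + 2 * m - (i + m) = j + m" "i + m \<le> d + 2 * m" using assms by auto
      then show ?thesis by (simp only: binomial_gbinomial[symmetric] binomial_fact)
    qed
    have e2: "(real (d + 2 * m) gchoose m) = fact (d + 2 * m) / (fact m * fact (d + m))"
    proof -
      have "d + 2 * m - m = d + m" "m \<le> d + 2 * m" by auto
      then show ?thesis by (simp only: binomial_gbinomial[symmetric] binomial_fact)
    qed
    have e3: "(real d gchoose i) = fact d / (fact i * fact j)"
    proof -
      have "d - i = j" "i \<le> d" using assms by auto
      then show ?thesis by (simp only: binomial_gbinomial[symmetric] binomial_fact)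
    qed
    show ?thesis unfolding e1 e2 e3 by (simp add: mult_ac)
  qed
  ultimately show ?thesis unfolding uniform_Z_coeff_def by simp
qed

lemma uniform_Z_coeff_sym:
  assumes "i \<le> d" "m > 0"
  shows "uniform_Z_coeff m d (d - i) = uniform_Z_coeff m d i"
  using assms uniform_Z_coeff_altdef[of i "d - i" d m] uniform_Z_coeff_altdef[of "d - i" i d m] zsum_commute[of m i "d - i"]
  by (simp add: mult_ac)

lemma uniform_Z_coeff_0: "m > 0 \<Longrightarrow> uniform_Z_coeff m d 0 = 1"
  using uniform_Z_coeff_altdef[of 0 d d m] by (simp add: zsum_0_left)

text \<open>Binomial inversion of the relation that expresses \<open>Z\<close> through the Kazhdan--Lusztig polynomials.\<close>

definition uniform_KL_coeff :: "nat \<Rightarrow> nat \<Rightarrow> nat \<Rightarrow> real" where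
  "uniform_KL_coeff m d i = (\<Sum>k\<le>i. (-1) ^ k * real (m + d choose k) * uniform_Z_coeff m (d - k) (i - k))"

text \<open>The closed form's counterpart of the degree bound on Kazhdan--Lusztig polynomials.
  Passing from \<open>(d, i)\<close> to \<open>(d - k, i - k)\<close> keeps \<open>j = d - i\<close>
  fixed, so \<open>k\<close> enters \<open>zsum\<close> only through its first index.\<close>

lemma uniform_KL_coeff_eq_0:
  assumes "m > 0" "i < d" "d \<le> 2 * i"
  shows "uniform_KL_coeff m d i = 0"
proof -
  define j where "j = d - i"
  have d: "d = i + j" and j: "0 < j" "j \<le> i" using assms by (auto simp: j_def)
  \<comment> \<open>\<open>W h\<close> collects the factors free of \<open>k\<close>; it is set to 0
    for \<open>h > j\<close>, where the summand vanishes.\<close>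
  define W where "W = (\<lambda>h. if h \<le> j then fact m * fact (m + d) / (fact (j + m) * fact j * real m * fact i) *
    ((-1) ^ (h + 1) * real h * (real j - real h + real m - 1 gchoose (m - 1))) * fact (j - h) / fact (m - h) else 0)"
  \<comment> \<open>After cancelling factorials, only summands that are polynomial in \<open>k\<close> of degree \<open>j - h < i\<close>
    survive, and the \<open>i\<close>-th difference kills them.\<close>
  have summand: "real (m + d choose k) * uniform_Z_coeff m (d - k) (i - k) =
      (\<Sum>h=1..m. W h * real (i choose k) * (real d - real k gchoose (j - h)))" if k: "k \<le> i" for k
  proof -
    define a where "a = i - k"
    have i: "i = a + k" using k by (simp add: a_def)
    let ?c = "fact (a + j) * (fact (m + d) / fact k) * fact m / (fact (a + m) * fact (j + m) * fact a * fact j * real m)"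
    \<comment> \<open>The denominator factorial of the binomial cancels against the numerator of the
      closed form at \<open>d - k\<close>.\<close>
    have e1: "real (m + d choose k) * fact (d - k + m) = fact (m + d) / fact k"
      using k assms by (simp add: binomial_fact add.commute)
    have "d - k = a + j" using i d by simp
    then have e2: "uniform_Z_coeff m (d - k) (i - k) = fact (a + j) * fact (d - k + m) * fact m /
        (fact (a + m) * fact (j + m) * fact a * fact j) * (zsum m a j / real m)"
      using uniform_Z_coeff_altdef[of a j "a + j" m] assms(1) by (simp add: a_def)
    have "real (m + d choose k) * uniform_Z_coeff m (d - k) (i - k) =
        (real (m + d choose k) * fact (d - k + m)) * (fact (a + j) * fact m /
        (fact (a + m) * fact (j + m) * fact a * fact j) * (zsum m a j / real m))"
      unfolding e2 by simp
    also have "\<dots> = ?c * zsum m a j"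
      unfolding e1 by simp
    finally have "real (m + d choose k) * uniform_Z_coeff m (d - k) (i - k) = ?c * zsum m a j" .
    also have "\<dots> = (\<Sum>h=1..m. W h * real (i choose k) * (real d - real k gchoose (j - h)))"
      unfolding zsum_def sum_distrib_left
    proof (intro sum.cong refl)
      fix h assume h: "h \<in> {1..m}"
      show "?c * ((-1) ^ (h + 1) * real h * (real (a + m) gchoose (m - h)) * (real j - real h + real m - 1 gchoose (m - 1))) =
          W h * real (i choose k) * (real d - real k gchoose (j - h))"
      proof (cases "h \<le> j")
        case True
        have e1: "(real (a + m) gchoose (m - h)) = fact (a + m) / (fact (m - h) * fact (a + h))"
          using h by (simp only: binomial_gbinomial[symmetric]) (simp add: binomial_fact)
        have e2: "(real d - real k gchoose (j - h)) = fact (a + j) / (fact (j - h) * fact (a + h))"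
        proof -
          have "real d - real k = real (a + j)" using i d by simp
          then show ?thesis
            using True by (simp only: binomial_gbinomial[symmetric]) (simp add: binomial_fact)
        qed
        have e3: "real (i choose k) = fact i / (fact k * fact a)"
          by (simp add: binomial_fact i)
        have e4: "W h = fact m * fact (m + d) / (fact (j + m) * fact j * real m * fact i) *
            ((-1) ^ (h + 1) * real h * (real j - real h + real m - 1 gchoose (m - 1))) * fact (j - h) / fact (m - h)"
          using True by (simp add: W_def)
        show ?thesis unfolding e1 e2 e3 e4 by (simp add: mult_ac)
      next
        case False
        have "real j - real h + real m - 1 = real (j + m - 1 - h)" "j + m - 1 - h < m - 1"
          using False h j by (auto simp: of_nat_diff)
        then have "(real j - real h + real m - 1 gchoose (m - 1)) = 0"
          by (simp only: binomial_gbinomial[symmetric] binomial_eq_0 of_nat_0)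
        then show ?thesis using False by (simp add: W_def)
      qed
    qed
    finally show ?thesis .
  qed
  have "uniform_KL_coeff m d i = (\<Sum>k\<le>i. \<Sum>h=1..m. W h * ((-1) ^ k * real (i choose k) * (real d - real k gchoose (j - h))))"
    unfolding uniform_KL_coeff_def
  proof (intro sum.cong refl)
    fix k assume "k \<in> {..i}"
    then have "(-1) ^ k * real (m + d choose k) * uniform_Z_coeff m (d - k) (i - k) =
        (-1) ^ k * (\<Sum>h=1..m. W h * real (i choose k) * (real d - real k gchoose (j - h)))"
      by (simp only: mult.assoc summand atMost_iff)
    then show "(-1) ^ k * real (m + d choose k) * uniform_Z_coeff m (d - k) (i - k) =
        (\<Sum>h=1..m. W h * ((-1) ^ k * real (i choose k) * (real d - real k gchoose (j - h))))"
      by (simp only: sum_distrib_left mult_ac)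
  qed
  also have "\<dots> = (\<Sum>h=1..m. W h * (\<Sum>k\<le>i. (-1) ^ k * real (i choose k) * (real d - real k gchoose (j - h))))"
    by (subst sum.swap) (simp add: sum_distrib_left)
  also have "\<dots> = 0"
    \<comment> \<open>The degree \<open>j - h\<close> is below \<open>i\<close> because
      \<open>h \<ge> 1\<close> and \<open>0 < j \<le> i\<close>.\<close>
    using j by (intro sum.neutral ballI) (subst alternating_sum_choose_gbinomial, auto)
  finally show ?thesis .
qed

text \<open>Collect the terms with \<open>k + l = s\<close>. The product of the two binomials is
  \<open>(?N choose s) * (s choose k)\<close>, and the alternating sum over \<open>k\<close>
  vanishes unless \<open>s = 0\<close>.\<close>

lemma sum_choose_uniform_KL_coeff:
  assumes "i \<le> d"
  shows "(\<Sum>k\<le>i. real (m + d choose k) * uniform_KL_coeff m (d - k) (i - k)) = uniform_Z_coeff m d i"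
proof -
  let ?N = "m + d"
  have "(\<Sum>k\<le>i. real (?N choose k) * uniform_KL_coeff m (d - k) (i - k)) =
      (\<Sum>k\<le>i. \<Sum>l\<le>i - k. real (?N choose k) * ((-1) ^ l * real (?N - k choose l) * uniform_Z_coeff m (d - (k + l)) (i - (k + l))))"
    unfolding uniform_KL_coeff_def sum_distrib_left using assms by (intro sum.cong refl) simp
  also have "\<dots> = (\<Sum>(k, l)\<in>{(k, l). k + l \<le> i}.
      real (?N choose k) * ((-1) ^ l * real (?N - k choose l) * uniform_Z_coeff m (d - (k + l)) (i - (k + l))))"
  proof -
    have "{(k, l). k + l \<le> i} = (SIGMA k:{..i}. {..i - k})" by auto
    then show ?thesis by (simp add: sum.Sigma)
  qed
  also have "\<dots> = (\<Sum>s\<le>i. \<Sum>k\<le>s.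
      real (?N choose k) * ((-1) ^ (s - k) * real (?N - k choose (s - k)) * uniform_Z_coeff m (d - (k + (s - k))) (i - (k + (s - k)))))"
    by (rule sum.triangle_reindex_eq)
  also have "\<dots> = (\<Sum>s\<le>i. real (?N choose s) * (-1) ^ s * uniform_Z_coeff m (d - s) (i - s) * (\<Sum>k\<le>s. (-1) ^ k * real (s choose k)))"
    unfolding sum_distrib_left
  proof (intro sum.cong refl)
    fix s k assume sk: "s \<in> {..i}" "k \<in> {..s}"
    have A: "real (?N choose k) * real (?N - k choose (s - k)) = real (?N choose s) * real (s choose k)"
      using choose_mult[of k s ?N] sk assms by (simp flip: of_nat_mult)
    have B: "(-1::real) ^ (s - k) = (-1) ^ s * (-1) ^ k"
    proof -
      obtain t where "s = k + t" using sk by (auto simp: le_iff_add)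
      then show ?thesis by (simp add: power_add mult_ac)
    qed
    have C: "k + (s - k) = s" using sk by simp
    have R: "real (?N choose k) * ((-1) ^ (s - k) * real (?N - k choose (s - k)) * z) =
        real (?N choose k) * real (?N - k choose (s - k)) * (-1) ^ (s - k) * z" for z
      by (simp only: mult_ac)
    show "real (?N choose k) * ((-1) ^ (s - k) * real (?N - k choose (s - k)) * uniform_Z_coeff m (d - (k + (s - k))) (i - (k + (s - k)))) =
        real (?N choose s) * (-1) ^ s * uniform_Z_coeff m (d - s) (i - s) * ((-1) ^ k * real (s choose k))"
      by (simp only: R, simp only: A B C, simp only: mult_ac)
  qed
  also have "\<dots> = (\<Sum>s\<le>i. if s = 0 then uniform_Z_coeff m d i else 0)"
    by (intro sum.cong refl) (auto simp: choose_alternating_sum)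
  also have "\<dots> = uniform_Z_coeff m d i" by simp
  finally show ?thesis .
qed

section \<open>Uniform matroids\<close>

lemma uniform_matroid_simps [simp]:
  "ground (uniform_matroid E d) = E"
  "indep (uniform_matroid E d) = {I. I \<subseteq> E \<and> card I \<le> d}"
  by (simp_all add: uniform_matroid_def)

lemma is_matroid_uniform:
  assumes "finite E"
  shows "is_matroid (uniform_matroid E d)"
  unfolding is_matroid_def
proof (intro conjI ballI allI impI)
  fix I J assume I: "I \<in> indep (uniform_matroid E d)" and J: "J \<in> indep (uniform_matroid E d)"
    and less: "card I < card J"
  have fin: "finite I" "finite J" using I J assms by (auto intro: finite_subset)
  then obtain x where "x \<in> J - I"
    using less card_mono[of I J] by (metis Diff_eq_empty_iff all_not_in_conv not_le)
  then show "\<exists>x\<in>J - I. insert x I \<in> indep (uniform_matroid E d)"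
    using I J less fin by (intro bexI[of _ x]) auto
next
  fix I J assume "I \<in> indep (uniform_matroid E d)" "J \<subseteq> I"
  then show "J \<in> indep (uniform_matroid E d)"
    using assms card_mono[of I J] by (auto intro: finite_subset order_trans)
qed (use assms in auto)

lemma loopless_uniform: "d > 0 \<Longrightarrow> loopless (uniform_matroid E d)"
  by (simp add: loopless_def)

lemma rank_of_uniform:
  assumes "finite E" "A \<subseteq> E"
  shows "rank_of (uniform_matroid E d) A = min (card A) d"
proof (rule antisym)
  note M = is_matroid_uniform[OF assms(1), of d]
  obtain B where "B \<in> indep (uniform_matroid E d)" "B \<subseteq> A" "card B = rank_of (uniform_matroid E d) A"
    using rank_of_basis[OF M] .
  then show "rank_of (uniform_matroid E d) A \<le> min (card A) d"
    using rank_of_le_card[OF M, of A] assms finite_subset by auto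
  obtain C where "C \<subseteq> A" "card C = min (card A) d"
    using obtain_subset_with_card_n[of "min (card A) d" A] by auto
  then show "min (card A) d \<le> rank_of (uniform_matroid E d) A"
    using card_le_rank_of[OF M, of C A] assms by auto
qed

lemma flats_uniform:
  assumes "finite E" "d < card E"
  shows "flats (uniform_matroid E d) = insert E {F. F \<subseteq> E \<and> card F < d}"
proof -
  have "(\<forall>x\<in>E - F. rank_of (uniform_matroid E d) F < rank_of (uniform_matroid E d) (insert x F)) \<longleftrightarrow>
      F = E \<or> card F < d" if "F \<subseteq> E" for F
  proof -
    have "finite F" using assms that by (auto intro: finite_subset)
    then have "rank_of (uniform_matroid E d) F < rank_of (uniform_matroid E d) (insert x F) \<longleftrightarrow> card F < d"
      if "x \<in> E - F" for x
      using that \<open>F \<subseteq> E\<close> assms(1) by (auto simp: rank_of_uniform)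
    then show ?thesis using that by auto
  qed
  then show ?thesis unfolding flats_def by auto
qed

text \<open>Size of the ground set and rank drop by the same amount, so \<open>m\<close> stays
  fixed; this permits an induction on \<open>d\<close> alone.\<close>

lemma contraction_uniform:
  assumes "finite E" "F \<subseteq> E" "card F \<le> d"
  shows "contraction (uniform_matroid E d) F = uniform_matroid (E - F) (d - card F)"
proof -
  have fin: "finite F" using assms finite_subset by auto
  have rank: "rank_of (uniform_matroid E d) F = card F" using assms by (simp add: rank_of_uniform)
  have "I \<in> indep (contraction (uniform_matroid E d) F) \<longleftrightarrow> card I \<le> d - card F" if I: "I \<subseteq> E - F" for I
  proof -
    have "finite I" using I assms(1) finite_subset by blast
    then have "card (I \<union> F) = card I + card F" using I fin by (intro card_Un_disjoint) auto
    moreover have "I \<union> F \<subseteq> E" using I assms(2) by auto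
    ultimately show ?thesis
      using I assms is_matroid_uniform[OF assms(1), of d]
      by (auto simp: indep_contraction_iff rank_of_uniform)
  qed
  moreover have "I \<subseteq> E - F" if "I \<in> indep (contraction (uniform_matroid E d) F)" for I
    using that by (simp add: contraction_def)
  ultimately show ?thesis
    by (intro matroid.expand) auto
qed

section \<open>Degree bounds and symmetry for \<open>KL_poly\<close> and
  \<open>Z_poly\<close>\<close>

lemma KL_poly_rk_0:
  assumes "is_matroid M" "loopless M" "rk M = 0"
  shows "KL_poly M = 1"
  using KL_assignment_KL_poly assms unfolding KL_assignment_def by auto

lemma coeff_KL_poly_eq_0:
  assumes "is_matroid M" "loopless M" "0 < rk M" "rk M \<le> 2 * i"
  shows "coeff (KL_poly M) i = 0"
  using KL_assignment_KL_poly assms unfolding KL_assignment_def by (intro coeff_eq_0) fastforce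

lemma degree_KL_poly_le:
  assumes "is_matroid M" "loopless M"
  shows "degree (KL_poly M) \<le> rk M"
  using KL_poly_rk_0[OF assms] coeff_KL_poly_eq_0[OF assms] by (cases "rk M = 0") (auto intro: degree_le)

lemma degree_Z_poly_le:
  assumes M: "is_matroid M" "loopless M"
  shows "degree (Z_poly M) \<le> rk M"
  unfolding Z_poly_def rk_restriction using M
  by (intro degree_sum_le degree_monom_mult_contraction_le degree_KL_poly_le
      is_matroid_contraction loopless_contraction finite_flats)

lemma coeff_Z_poly_sym:
  assumes "is_matroid M" "loopless M" "i \<le> rk M"
  shows "coeff (Z_poly M) (rk M - i) = coeff (Z_poly M) i"
proof -
  have "rev_poly (rk M) (Z_poly M) = Z_poly M"
    using KL_assignment_KL_poly assms unfolding KL_assignment_iff Z_poly_eq_Z_of by auto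
  then have "coeff (rev_poly (rk M) (Z_poly M)) i = coeff (Z_poly M) i" by simp
  then show ?thesis using assms by (simp add: coeff_rev_poly degree_Z_poly_le)
qed

section \<open>Coefficients for uniform matroids\<close>

lemma Z_poly_uniform:
  assumes "finite E" "d < card E" "d > 0"
  shows "Z_poly (uniform_matroid E d) = monom 1 d +
    (\<Sum>F | F \<subseteq> E \<and> card F < d. monom 1 (card F) * KL_poly (uniform_matroid (E - F) (d - card F)))"
proof -
  let ?M = "uniform_matroid E d"
  note M = is_matroid_uniform[OF assms(1), of d]
  \<comment> \<open>The flat \<open>E\<close> has rank \<open>d\<close> and a contraction of rank 0,
    so it contributes exactly \<open>monom 1 d\<close>.\<close>
  have "rk (contraction ?M E) = 0"
    using rk_contraction[OF M, of E] by (simp add: rk_def)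
  then have "KL_poly (contraction ?M E) = 1"
    using ground_in_flats[of ?M]
    by (intro KL_poly_rk_0 is_matroid_contraction loopless_contraction M) auto
  moreover have "finite {F. F \<subseteq> E \<and> card F < d}" using assms(1) by simp
  ultimately show ?thesis
    unfolding Z_poly_def rk_restriction flats_uniform[OF assms(1,2)] using assms
    by (subst sum.insert) (auto simp: rank_of_uniform contraction_uniform intro!: sum.cong)
qed

lemma coeff_Z_poly_uniform:
  assumes "finite E" "d < card E" "i < d"
  shows "coeff (Z_poly (uniform_matroid E d)) i =
    (\<Sum>F | F \<subseteq> E \<and> card F \<le> i. coeff (KL_poly (uniform_matroid (E - F) (d - card F))) (i - card F))"
proof -
  have "coeff (Z_poly (uniform_matroid E d)) i = (\<Sum>F | F \<subseteq> E \<and> card F < d.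
      if card F \<le> i then coeff (KL_poly (uniform_matroid (E - F) (d - card F))) (i - card F) else 0)"
    using assms by (auto simp: Z_poly_uniform coeff_sum coeff_monom_mult intro!: sum.cong)
  also have "\<dots> = (\<Sum>F\<in>{F. F \<subseteq> E \<and> card F < d} \<inter> {F. card F \<le> i}.
      coeff (KL_poly (uniform_matroid (E - F) (d - card F))) (i - card F))"
    using assms(1) by (subst sum.inter_restrict) auto
  also have "{F. F \<subseteq> E \<and> card F < d} \<inter> {F. card F \<le> i} = {F. F \<subseteq> E \<and> card F \<le> i}"
    using assms(3) by auto
  finally show ?thesis .
qed

lemma coeff_Z_poly_uniform_top:
  assumes "finite E" "d < card E" "d > 0"
  shows "coeff (Z_poly (uniform_matroid E d)) d = 1"
proof -
  \<comment> \<open>This is the coefficient of a Kazhdan--Lusztig polynomial at the full rank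
    \<open>d - card F > 0\<close>, beyond its degree bound.\<close>
  have "coeff (monom 1 (card F) * KL_poly (uniform_matroid (E - F) (d - card F))) d = 0"
    if F: "F \<subseteq> E" "card F < d" for F
  proof -
    have "card (E - F) = card E - card F"
      using F assms by (intro card_Diff_subset) (auto intro: finite_subset)
    then have "rk (uniform_matroid (E - F) (d - card F)) = d - card F"
      using F assms by (simp add: rk_def rank_of_uniform)
    then show ?thesis
      using F assms coeff_KL_poly_eq_0[OF is_matroid_uniform loopless_uniform, of "E - F" "d - card F" "d - card F"]
      by (simp add: coeff_monom_mult)
  qed
  then show ?thesis using assms by (simp add: Z_poly_uniform coeff_sum)
qed

lemma sum_subsets_by_card:
  fixes g :: "nat \<Rightarrow> real"
  assumes "finite E"
  shows "(\<Sum>F | F \<subseteq> E \<and> card F \<le> i. g (card F)) = (\<Sum>k\<le>i. real (card E choose k) * g k)"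
proof -
  have "(\<Sum>F | F \<subseteq> E \<and> card F \<le> i. g (card F)) =
      (\<Sum>k\<le>i. \<Sum>F\<in>{F \<in> {F. F \<subseteq> E \<and> card F \<le> i}. card F = k}. g (card F))"
    using assms by (intro sum.group[symmetric]) auto
  also have "\<dots> = (\<Sum>k\<le>i. real (card E choose k) * g k)"
  proof (intro sum.cong refl)
    fix k assume "k \<in> {..i}"
    then have "{F \<in> {F. F \<subseteq> E \<and> card F \<le> i}. card F = k} = {F. F \<subseteq> E \<and> card F = k}" by auto
    then show "(\<Sum>F\<in>{F \<in> {F. F \<subseteq> E \<and> card F \<le> i}. card F = k}. g (card F)) = real (card E choose k) * g k"
      using n_subsets[OF assms, of k] by simp
  qed
  finally show ?thesis .
qed

text \<open>By induction on \<open>d\<close> the contributions of nonempty flats are known. For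
  \<open>d \<le> 2 * i\<close> the Kazhdan--Lusztig coefficient and its candidate both vanish, which
  determines the upper half of \<open>Z\<close>; symmetry gives the lower half, and then the
  Kazhdan--Lusztig coefficients follow.\<close>

lemma coeffs_uniform_matroid:
  assumes "m > 0" "d > 0" "finite E" "card E = m + d" "i < d"
  shows "real_of_int (coeff (KL_poly (uniform_matroid E d)) i) = uniform_KL_coeff m d i \<and>
    real_of_int (coeff (Z_poly (uniform_matroid E d)) i) = uniform_Z_coeff m d i"
  using assms(2-)
proof (induction d arbitrary: E i rule: less_induct)
  case (less d)
  let ?M = "uniform_matroid E d"
  note M = is_matroid_uniform[OF less.prems(2), of d] loopless_uniform[OF less.prems(1), of E]
  have dE: "d < card E" using less.prems assms(1) by simp
  have rk: "rk ?M = d" using less.prems by (simp add: rk_def rank_of_uniform)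
  \<comment> \<open>Only the flat \<open>{}\<close> is not covered by the induction hypothesis; the
    identity keeps its unknown coefficient next to the candidate that it should equal.\<close>
  have Z: "real_of_int (coeff (Z_poly ?M) i) = real_of_int (coeff (KL_poly ?M) i) - uniform_KL_coeff m d i + uniform_Z_coeff m d i"
    if i: "i < d" for i
  proof -
    let ?A = "{F. F \<subseteq> E \<and> card F \<le> i}"
    let ?c = "\<lambda>F. real_of_int (coeff (KL_poly (uniform_matroid (E - F) (d - card F))) (i - card F))"
    have fin: "finite ?A" "{} \<in> ?A" using less.prems by auto
    have "?c F = uniform_KL_coeff m (d - card F) (i - card F)" if F: "F \<in> ?A - {{}}" for F
    proof -
      have finF: "finite F" using F less.prems by (auto intro: finite_subset)
      then have "card (E - F) = card E - card F" using F by (intro card_Diff_subset) auto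
      moreover have "0 < card F" using F finF by (auto simp: card_gt_0_iff)
      ultimately show ?thesis
        using F i less.prems by (intro less.IH[THEN conjunct1]) auto
    qed
    then have "(\<Sum>F\<in>?A - {{}}. ?c F) = (\<Sum>F\<in>?A - {{}}. uniform_KL_coeff m (d - card F) (i - card F))"
      by (intro sum.cong) auto
    then have "(\<Sum>F\<in>?A. ?c F) = ?c {} - uniform_KL_coeff m d i + (\<Sum>F\<in>?A. uniform_KL_coeff m (d - card F) (i - card F))"
      using sum.remove[OF fin, of ?c] sum.remove[OF fin, of "\<lambda>F. uniform_KL_coeff m (d - card F) (i - card F)"]
      by simp
    also have "(\<Sum>F\<in>?A. uniform_KL_coeff m (d - card F) (i - card F)) = uniform_Z_coeff m d i"
      using sum_subsets_by_card[OF less.prems(2), of "\<lambda>k. uniform_KL_coeff m (d - k) (i - k)" i]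
        sum_choose_uniform_KL_coeff[of i d m] i less.prems by simp
    finally show ?thesis
      using coeff_Z_poly_uniform[OF less.prems(2) dE i] by simp
  qed
  have upper: "real_of_int (coeff (Z_poly ?M) i) = uniform_Z_coeff m d i" if "i < d" "d \<le> 2 * i" for i
    using that Z[of i] uniform_KL_coeff_eq_0[of m i d] coeff_KL_poly_eq_0[OF M, of i] rk assms(1) by simp
  have "real_of_int (coeff (Z_poly ?M) i) = uniform_Z_coeff m d i"
  proof (cases "d \<le> 2 * i")
    case True
    then show ?thesis using upper less.prems by simp
  next
    case False
    have "coeff (Z_poly ?M) i = coeff (Z_poly ?M) (d - i)"
      using coeff_Z_poly_sym[OF M, of i] rk less.prems by simp
    also have "real_of_int \<dots> = uniform_Z_coeff m d (d - i)"
    \<comment> \<open>The reflection of 0 is the top degree \<open>d\<close>, which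
      \<open>upper\<close> excludes; there both sides are 1.\<close>
    proof (cases "i = 0")
      case True
      then show ?thesis
        using uniform_Z_coeff_sym[of 0 d m] uniform_Z_coeff_0 assms(1) coeff_Z_poly_uniform_top[OF less.prems(2) dE less.prems(1)] by simp
    next
      case i: False
      then show ?thesis using False less.prems by (intro upper) auto
    qed
    also have "\<dots> = uniform_Z_coeff m d i" using less.prems assms(1) by (intro uniform_Z_coeff_sym) auto
    finally show ?thesis .
  qed
  then show ?case using Z[OF less.prems(4)] by simp
qed

theorem theorem3p1:
  fixes m d :: nat and E :: "'a set"
  assumes "m > 0" and "d > 0" and "finite E" and "card E = m + d"
  shows "coeff (Z_poly (uniform_matroid E d)) d = 1 \<and>
    (\<forall>i\<le>d - 1. real_of_int (coeff (Z_poly (uniform_matroid E d)) i) =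
       (real (d + 2 * m) gchoose (i + m)) * (real d gchoose i) / (real (d + 2 * m) gchoose m) *
       (\<Sum>h=1..m. (-1) ^ (h + 1) * real h / real m * (real (i + m) gchoose (m - h)) *
          ((real d - real i - real h + real m - 1) gchoose (m - 1))))"
proof (intro conjI allI impI)
  show "coeff (Z_poly (uniform_matroid E d)) d = 1"
    using assms by (intro coeff_Z_poly_uniform_top) auto
  fix i assume "i \<le> d - 1"
  then show "real_of_int (coeff (Z_poly (uniform_matroid E d)) i) =
       (real (d + 2 * m) gchoose (i + m)) * (real d gchoose i) / (real (d + 2 * m) gchoose m) *
       (\<Sum>h=1..m. (-1) ^ (h + 1) * real h / real m * (real (i + m) gchoose (m - h)) *
          ((real d - real i - real h + real m - 1) gchoose (m - 1)))"
    using assms coeffs_uniform_matroid[of m d E i, THEN conjunct2] unfolding uniform_Z_coeff_def by simp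
qed

end
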